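(* Let $\mathcal{A}$ be the DP-SPRT algorithm (defined in the context) for Bernoulli observations, run with noise distributions $\mathcal{D}_Z,\mathcal{D}_Y$, and let $\tau$ be its (random) stopping time. (i) If the noise-adding mechanisms corresponding to $\mathcal{D}_Z$ and $\mathcal{D}_Y$ satisfy, respectively, $\epsilon_Z$-DP for queries with sensitivity $1$ and $\epsilon_Y$-DP for queries with sensitivity $2$, then DP-SPRT satisfies $(\epsilon_Z+\epsilon_Y)$-DP. (ii) If the noise-adding mechanisms corresponding to $\mathcal{D}_Z$ and $\mathcal{D}_Y$ have, respectively, an RDP profile $\epsilon_Z(\cdot)$ for queries with sensitivity $1$ and an RDP profile $\epsilon_Y(\cdot)$ for queries with sensitivity $2$, then for all $\alpha>1$ and all neighboring observation sequences $D,D'$, $$D_\alpha(\mathcal{A}(D)\,\|\,\mathcal{A}(D'))\le\frac{\alpha-1/2}{\alpha-1}\,\epsilon_Z(2\alpha)+\epsilon_Y(\alpha)+\frac{\log\left(2\,\mathbb{E}_{z\sim\mathcal{D}_Z}\left[\mathbb{E}_{(\tau,\hat d)\sim\mathcal{A}(D')}[\tau\mid Z=z]^2\right]\right)}{2(\alpha-1)}.$$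
   Context: Observation sequences are infinite sequences $\underline{X}=(X_1,X_2,\dots)\in\{0,1\}^{\mathbb{N}}$; two are neighboring if they differ in at most one index. Noise-adding mechanism: given a continuous distribution $\mathcal{D}$ on $\mathbb{R}$ (having a density), it maps a dataset $D$ and a real-valued query $f$ to $f(D)+X$, $X\sim\mathcal{D}$. The sensitivity of $f$ is $\max_{D,D'\text{ neighboring}}|f(D)-f(D')|$; "sensitivity $\Delta$" means at most $\Delta$, and a property holds "for queries with sensitivity $\Delta$" if it holds for every such query. Privacy: a randomized mechanism $\mathcal{M}$ is $\epsilon$-DP if $\Pr[\mathcal{M}(D)\in S]\le e^\epsilon\Pr[\mathcal{M}(D')\in S]$ for all neighboring $D,D'$ and measurable output sets $S$ (for a sequential test with output $(\tau,\hat d)$: $\Pr[\mathcal{M}(D)=(t,d)]\le e^\epsilon\Pr[\mathcal{M}(D')=(t,d)]$ for all $(t,d)\in\mathbb{N}\times\{0,1\}$). It is $(\alpha,\epsilon)$-RDP if $D_\alpha(\mathcal{M}(D)\|\mathcal{M}(D'))\le\epsilon$ for all neighboring $D,D'$, where $D_\alpha(P\|Q)=\frac{1}{\alpha-1}\log\mathbb{E}_{x\sim Q}[(P(x)/Q(x))^\alpha]$. It has RDP profile $\epsilon(\cdot)$ if it is $(\alpha,\epsilon(\alpha))$-RDP for all $\alpha>1$. DP-SPRT: parameters are natural parameters $\theta_0<\theta_1$ of Bernoulli distributions $\nu_{\theta_0},\nu_{\theta_1}$ ($\nu_\theta$ has mean $e^{\theta}/(1+e^{\theta})$; write $\mu_i$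 for the mean of $\nu_{\theta_i}$), error levels (for the test) $\alpha_{\mathrm{err}},\beta_{\mathrm{err}}\in(0,1)$, an allocation $\gamma\in(0,1)$, a correction function $C(n,\delta)$, and noise distributions $\mathcal{D}_Y,\mathcal{D}_Z$. Sample $Z\sim\mathcal{D}_Z$ once and $Y_1,Y_2,\dots$ i.i.d. from $\mathcal{D}_Y$, all independent of each other and of the data. With $\bar X_n=\frac1n\sum_{i=1}^nX_i$ and $$\tilde\ell_0^n=\mu_0+\frac{\mathrm{KL}(\nu_{\theta_0},\nu_{\theta_1})-\frac{\log(1/(\gamma\beta_{\mathrm{err}}))}{n}}{\theta_1-\theta_0}-C(n,(1-\gamma)\beta_{\mathrm{err}}),$$ $$\tilde\ell_1^n=\mu_1-\frac{\mathrm{KL}(\nu_{\theta_1},\nu_{\theta_0})-\frac{\log(1/(\gamma\alpha_{\mathrm{err}}))}{n}}{\theta_1-\theta_0}+C(n,(1-\gamma)\alpha_{\mathrm{err}}),$$ set $\tau_0=\inf\{n\ge1:\bar X_n+\frac{Y_n}{n}\le\tilde\ell_0^n-\frac Zn\}$, $\tau_1=\inf\{n\ge1:\bar X_n+\frac{Y_n}{n}\ge\tilde\ell_1^n+\frac Zn\}$, $\tau=\min(\tau_0,\tau_1)$, and $\hat d=i$ if $\tau=\tau_i$ (the condition for $i=0$ is checked first, so ties give $\hat d=0$). The output is $\mathcal{A}(\underline{X})=(\tau,\hat d)$. Here $\mathrm{KL}$ is the Kullback–Leibler divergence. *)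

theory Defs
  imports "HOL-Probability.Probability"
begin

section \<open>Observations, neighboring sequences, noise-adding mechanisms\<close>

text \<open>The observation \<open>X\<^sub>i\<close> (\<open>i \<ge> 1\<close>) is \<open>of_bool (x (i - 1))\<close>.\<close>

type_synonym obs = "nat \<Rightarrow> bool"

definition neighboring :: "obs \<Rightarrow> obs \<Rightarrow> bool" where
  "neighboring x x' \<longleftrightarrow> (\<exists>k. \<forall>i. i \<noteq> k \<longrightarrow> x i = x' i)"

definition has_sensitivity :: "(obs \<Rightarrow> real) \<Rightarrow> real \<Rightarrow> bool" where
  "has_sensitivity f \<Delta> \<longleftrightarrow> (\<forall>x x'. neighboring x x' \<longrightarrow> \<bar>f x - f x'\<bar> \<le> \<Delta>)"

definition continuous_distribution :: "real measure \<Rightarrow> bool" where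
  "continuous_distribution D \<longleftrightarrow>
     prob_space D \<and> (\<exists>f :: real \<Rightarrow> ennreal. f \<in> borel_measurable borel \<and> D = density lborel f)"

definition noise_mech :: "real measure \<Rightarrow> (obs \<Rightarrow> real) \<Rightarrow> obs \<Rightarrow> real measure" where
  "noise_mech D f x = distr D borel (\<lambda>w. f x + w)"

section \<open>Privacy\<close>

definition dp :: "real \<Rightarrow> (obs \<Rightarrow> 'o measure) \<Rightarrow> bool" where
  "dp \<epsilon> M \<longleftrightarrow> (\<forall>x x'. neighboring x x' \<longrightarrow>
     (\<forall>S \<in> sets (M x). measure (M x) S \<le> exp \<epsilon> * measure (M x') S))"

text \<open>
  The output of a sequential test is a pair of a stopping time, which is \<open>\<infinity>\<close> if the test never
  stops, and a decision. Its privacy is required at each point of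
  \<open>\<nat> \<times> {0,1}\<close>.
\<close>

definition test_dp :: "real \<Rightarrow> (obs \<Rightarrow> (enat \<times> nat) measure) \<Rightarrow> bool" where
  "test_dp \<epsilon> M \<longleftrightarrow> (\<forall>x x'. neighboring x x' \<longrightarrow>
     (\<forall>t :: nat. \<forall>d \<in> {0, 1}.
        measure (M x) {(enat t, d)} \<le> exp \<epsilon> * measure (M x') {(enat t, d)}))"

definition ln_ennreal :: "ennreal \<Rightarrow> ereal" where
  "ln_ennreal x = (if x = 0 then - \<infinity> else if x = \<infinity> then \<infinity> else ereal (ln (enn2real x)))"

text \<open>
  The likelihood ratio \<open>P(x)/Q(x)\<close> is the Radon--Nikodym derivative of \<open>P\<close> with respect to \<open>Q\<close>
  (the library writes the dominating measure first); as usual the divergence is \<open>\<infinity>\<close> if \<open>P\<close> is not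
  absolutely continuous with respect to \<open>Q\<close>. It is used for \<open>\<alpha> > 1\<close> and probability measures, where
  the derivative is finite almost everywhere.
\<close>

definition renyi_div :: "real \<Rightarrow> 'o measure \<Rightarrow> 'o measure \<Rightarrow> ereal" where
  "renyi_div \<alpha> P Q =
     (if absolutely_continuous Q P
      then ereal (1 / (\<alpha> - 1)) *
           ln_ennreal (\<integral>\<^sup>+ x. ennreal (enn2real (RN_deriv Q P x) powr \<alpha>) \<partial>Q)
      else \<infinity>)"

definition rdp :: "real \<Rightarrow> real \<Rightarrow> (obs \<Rightarrow> 'o measure) \<Rightarrow> bool" where
  "rdp \<alpha> \<epsilon> M \<longleftrightarrow> (\<forall>x x'. neighboring x x' \<longrightarrow> renyi_div \<alpha> (M x) (M x') \<le> ereal \<epsilon>)"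

definition rdp_profile :: "(real \<Rightarrow> real) \<Rightarrow> (obs \<Rightarrow> 'o measure) \<Rightarrow> bool" where
  "rdp_profile \<epsilon> M \<longleftrightarrow> (\<forall>\<alpha>>1. rdp \<alpha> (\<epsilon> \<alpha>) M)"

section \<open>The Bernoulli model and the thresholds\<close>

definition bern_mean :: "real \<Rightarrow> real" where
  "bern_mean \<theta> = exp \<theta> / (1 + exp \<theta>)"

definition bern :: "real \<Rightarrow> bool measure" where
  "bern \<theta> = measure_pmf (bernoulli_pmf (bern_mean \<theta>))"

text \<open>
  The library's \<^const>\<open>KL_divergence\<close> takes the logarithm's base first and the dominating measure
  second, so \<open>KL P Q\<close> with natural logarithm is \<open>KL_divergence (exp 1) Q P\<close>.
\<close>

definition KL :: "'a measure \<Rightarrow> 'a measure \<Rightarrow> real" where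
  "KL P Q = KL_divergence (exp 1) Q P"

definition ell0 ::
  "real \<Rightarrow> real \<Rightarrow> real \<Rightarrow> real \<Rightarrow> (nat \<Rightarrow> real \<Rightarrow> real) \<Rightarrow> nat \<Rightarrow> real" where
  "ell0 \<theta>0 \<theta>1 \<beta>err \<gamma> C n =
     bern_mean \<theta>0
     + (KL (bern \<theta>0) (bern \<theta>1) - ln (1 / (\<gamma> * \<beta>err)) / real n) / (\<theta>1 - \<theta>0)
     - C n ((1 - \<gamma>) * \<beta>err)"

definition ell1 ::
  "real \<Rightarrow> real \<Rightarrow> real \<Rightarrow> real \<Rightarrow> (nat \<Rightarrow> real \<Rightarrow> real) \<Rightarrow> nat \<Rightarrow> real" where
  "ell1 \<theta>0 \<theta>1 \<alpha>err \<gamma> C n =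
     bern_mean \<theta>1
     - (KL (bern \<theta>1) (bern \<theta>0) - ln (1 / (\<gamma> * \<alpha>err)) / real n) / (\<theta>1 - \<theta>0)
     + C n ((1 - \<gamma>) * \<alpha>err)"

section \<open>The algorithm\<close>

definition obs_mean :: "obs \<Rightarrow> nat \<Rightarrow> real" where
  "obs_mean x n = (\<Sum>i<n. of_bool (x i)) / real n"

definition first_time :: "(nat \<Rightarrow> bool) \<Rightarrow> enat" where
  "first_time P = Inf (enat ` {n. 1 \<le> n \<and> P n})"

definition tau0 :: "(nat \<Rightarrow> real) \<Rightarrow> obs \<Rightarrow> real \<Rightarrow> (nat \<Rightarrow> real) \<Rightarrow> enat" where
  "tau0 l0 x z y =
     first_time (\<lambda>n. obs_mean x n + y n / real n \<le> l0 n - z / real n)"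

definition tau1 :: "(nat \<Rightarrow> real) \<Rightarrow> obs \<Rightarrow> real \<Rightarrow> (nat \<Rightarrow> real) \<Rightarrow> enat" where
  "tau1 l1 x z y =
     first_time (\<lambda>n. obs_mean x n + y n / real n \<ge> l1 n + z / real n)"

definition test_output ::
  "(nat \<Rightarrow> real) \<Rightarrow> (nat \<Rightarrow> real) \<Rightarrow> obs \<Rightarrow> real \<Rightarrow> (nat \<Rightarrow> real) \<Rightarrow> enat \<times> nat" where
  "test_output l0 l1 x z y =
     (min (tau0 l0 x z y) (tau1 l1 x z y),
      if tau0 l0 x z y \<le> tau1 l1 x z y then 0 else 1)"

definition query_noise :: "real measure \<Rightarrow> (nat \<Rightarrow> real) measure" where
  "query_noise DY = PiM {1..} (\<lambda>_. DY)"

definition noise_space :: "real measure \<Rightarrow> real measure \<Rightarrow> (real \<times> (nat \<Rightarrow> real)) measure" where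
  "noise_space DZ DY = DZ \<Otimes>\<^sub>M query_noise DY"

definition dp_sprt ::
  "real \<Rightarrow> real \<Rightarrow> real \<Rightarrow> real \<Rightarrow> real \<Rightarrow> (nat \<Rightarrow> real \<Rightarrow> real) \<Rightarrow>
   real measure \<Rightarrow> real measure \<Rightarrow> obs \<Rightarrow> (enat \<times> nat) measure" where
  "dp_sprt \<theta>0 \<theta>1 \<alpha>err \<beta>err \<gamma> C DZ DY x =
     distr (noise_space DZ DY) (count_space UNIV)
       (\<lambda>(z, y). test_output (ell0 \<theta>0 \<theta>1 \<beta>err \<gamma> C) (ell1 \<theta>0 \<theta>1 \<alpha>err \<gamma> C) x z y)"

text \<open>
  Since \<open>Z\<close> is independent of the \<open>Y\<^sub>n\<close>, conditioning on \<open>Z = z\<close> amounts to averaging over the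
  \<open>Y\<^sub>n\<close> with \<open>z\<close> held fixed; the lemma \<open>cond_exp_tau_is_nn_cond_exp\<close> below shows that this is a
  version of the conditional expectation of the stopping time given \<open>Z\<close>.
\<close>

definition cond_exp_tau ::
  "real \<Rightarrow> real \<Rightarrow> real \<Rightarrow> real \<Rightarrow> real \<Rightarrow> (nat \<Rightarrow> real \<Rightarrow> real) \<Rightarrow>
   real measure \<Rightarrow> obs \<Rightarrow> real \<Rightarrow> ennreal" where
  "cond_exp_tau \<theta>0 \<theta>1 \<alpha>err \<beta>err \<gamma> C DY x z =
     (\<integral>\<^sup>+ y. ennreal_of_enat
        (fst (test_output (ell0 \<theta>0 \<theta>1 \<beta>err \<gamma> C) (ell1 \<theta>0 \<theta>1 \<alpha>err \<gamma> C) x z y))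
      \<partial>query_noise DY)"

section \<open>Well-definedness\<close>

lemma first_time_le_iff: "first_time P \<le> enat n \<longleftrightarrow> (\<exists>m\<in>{1..n}. P m)"
proof
  assume le: "first_time P \<le> enat n"
  have ne: "enat ` {n. 1 \<le> n \<and> P n} \<noteq> {}"
  proof
    assume "enat ` {n. 1 \<le> n \<and> P n} = {}"
    then have "first_time P = \<infinity>" by (simp only: first_time_def Inf_empty top_enat_def)
    with le show False by simp
  qed
  then have "Inf (enat ` {n. 1 \<le> n \<and> P n}) \<in> enat ` {n. 1 \<le> n \<and> P n}"
    by (meson wellorder_InfI ex_in_conv)
  then obtain m where "1 \<le> m" "P m" "first_time P = enat m"
    by (auto simp: first_time_def)
  with le show "\<exists>m\<in>{1..n}. P m" by auto
next
  assume "\<exists>m\<in>{1..n}. P m"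
  then obtain m where "1 \<le> m" "m \<le> n" "P m" by auto
  then have "first_time P \<le> enat m"
    by (auto simp: first_time_def intro!: Inf_lower)
  then show "first_time P \<le> enat n" using \<open>m \<le> n\<close> by (meson enat_ord_simps(1) order.trans)
qed

lemma measurable_enat_le:
  fixes f :: "'a \<Rightarrow> enat"
  assumes "\<And>n. {w \<in> space M. f w \<le> enat n} \<in> sets M"
  shows "f \<in> measurable M (count_space UNIV)"
proof -
  have "f -` {a} \<inter> space M \<in> sets M" for a
  proof (cases a)
    case infinity
    have "f -` {a} \<inter> space M = space M - (\<Union>n. {w \<in> space M. f w \<le> enat n})"
    proof -
      have "f w = \<infinity> \<longleftrightarrow> (\<forall>n. \<not> f w \<le> enat n)" for w
        by (cases "f w") auto
      then show ?thesis unfolding infinity by auto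
    qed
    also have "\<dots> \<in> sets M" using assms by auto
    finally show ?thesis .
  next
    case (enat n)
    have "f -` {a} \<inter> space M
        = {w \<in> space M. f w \<le> enat n} - (\<Union>m\<in>{..<n}. {w \<in> space M. f w \<le> enat m})"
    proof -
      have "f w = enat n \<longleftrightarrow> f w \<le> enat n \<and> (\<forall>m<n. \<not> f w \<le> enat m)" for w
        by (cases "f w") (auto simp: le_less)
      then show ?thesis unfolding enat by auto
    qed
    also have "\<dots> \<in> sets M" using assms by auto
    finally show ?thesis .
  qed
  then show ?thesis by (subst measurable_count_space_eq2_countable) auto
qed

lemma continuous_distributionD:
  assumes "continuous_distribution D"
  shows "prob_space D" "sets D = sets borel" "space D = UNIV"
  using assms by (auto simp: continuous_distribution_def)

lemma prob_space_query_noise: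
  assumes "continuous_distribution DY" shows "prob_space (query_noise DY)"
  unfolding query_noise_def
  by (intro prob_space_PiM continuous_distributionD assms)

lemma prob_space_noise_space:
  assumes "continuous_distribution DZ" "continuous_distribution DY"
  shows "prob_space (noise_space DZ DY)"
proof -
  interpret DZ: prob_space DZ by (rule continuous_distributionD[OF assms(1)])
  interpret Q: prob_space "query_noise DY" by (rule prob_space_query_noise[OF assms(2)])
  interpret pair_prob_space DZ "query_noise DY" ..
  show ?thesis unfolding noise_space_def by (rule P.prob_space_axioms)
qed

lemma measurable_test_output:
  assumes DZ: "continuous_distribution DZ" and DY: "continuous_distribution DY"
  shows "(\<lambda>(z, y). test_output l0 l1 x z y) \<in> measurable (noise_space DZ DY) (count_space UNIV)"
proof -
  let ?M = "noise_space DZ DY"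
  have z [measurable]: "fst \<in> borel_measurable ?M"
    unfolding noise_space_def
    using measurable_fst[of DZ "query_noise DY"] continuous_distributionD(2)[OF DZ]
    by (simp cong: measurable_cong_sets)
  have y [measurable]: "(\<lambda>w. snd w n) \<in> borel_measurable ?M" if "1 \<le> n" for n
  proof -
    have "(\<lambda>w. snd w n) \<in> measurable ?M DY"
      unfolding noise_space_def query_noise_def
      by (rule measurable_compose[OF measurable_snd measurable_component_singleton])
        (use that in auto)
    then show ?thesis using continuous_distributionD(2)[OF DY] by (simp cong: measurable_cong_sets)
  qed
  have t0: "(\<lambda>w. tau0 l0 x (fst w) (snd w)) \<in> measurable ?M (count_space UNIV)"
    unfolding tau0_def
  proof (rule measurable_enat_le, unfold first_time_le_iff)
    fix n
    have "{w \<in> space ?M. \<exists>m\<in>{1..n}. obs_mean x m + snd w m / real m \<le> l0 m - fst w / real m}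
      = (\<Union>m\<in>{1..n}. {w \<in> space ?M. obs_mean x m + snd w m / real m \<le> l0 m - fst w / real m})"
      by auto
    also have "\<dots> \<in> sets ?M"
      by (intro sets.finite_UN borel_measurable_le) (use y in \<open>auto intro!: borel_measurable_add borel_measurable_diff borel_measurable_divide z\<close>)
    finally show "{w \<in> space ?M. \<exists>m\<in>{1..n}. obs_mean x m + snd w m / real m \<le> l0 m - fst w / real m}
      \<in> sets ?M" .
  qed
  have t1: "(\<lambda>w. tau1 l1 x (fst w) (snd w)) \<in> measurable ?M (count_space UNIV)"
    unfolding tau1_def
  proof (rule measurable_enat_le, unfold first_time_le_iff)
    fix n
    have "{w \<in> space ?M. \<exists>m\<in>{1..n}. obs_mean x m + snd w m / real m \<ge> l1 m + fst w / real m}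
      = (\<Union>m\<in>{1..n}. {w \<in> space ?M. l1 m + fst w / real m \<le> obs_mean x m + snd w m / real m})"
      by auto
    also have "\<dots> \<in> sets ?M"
      by (intro sets.finite_UN borel_measurable_le) (use y in \<open>auto intro!: borel_measurable_add borel_measurable_diff borel_measurable_divide z\<close>)
    finally show "{w \<in> space ?M. \<exists>m\<in>{1..n}. obs_mean x m + snd w m / real m \<ge> l1 m + fst w / real m}
      \<in> sets ?M" .
  qed
  let ?g = "\<lambda>(a :: enat, b :: enat). (min a b, if a \<le> b then 0 else 1 :: nat)"
  have "(\<lambda>w. (tau0 l0 x (fst w) (snd w), tau1 l1 x (fst w) (snd w)))
      \<in> measurable ?M (count_space UNIV \<Otimes>\<^sub>M count_space UNIV)"
    using t0 t1 by measurable
  then have "(\<lambda>w. (tau0 l0 x (fst w) (snd w), tau1 l1 x (fst w) (snd w)))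
      \<in> measurable ?M (count_space UNIV)"
    by (simp add: pair_measure_countable)
  then have "(\<lambda>w. ?g (tau0 l0 x (fst w) (snd w), tau1 l1 x (fst w) (snd w)))
      \<in> measurable ?M (count_space UNIV)"
    by (rule measurable_compose) simp
  then show ?thesis
    by (simp add: test_output_def case_prod_beta)
qed

lemma prob_space_dp_sprt:
  assumes "continuous_distribution DZ" "continuous_distribution DY"
  shows "prob_space (dp_sprt \<theta>0 \<theta>1 \<alpha>err \<beta>err \<gamma> C DZ DY x)"
  unfolding dp_sprt_def
  by (intro prob_space.prob_space_distr prob_space_noise_space measurable_test_output assms)

lemma cond_exp_tau_is_nn_cond_exp:
  fixes C :: "nat \<Rightarrow> real \<Rightarrow> real" and \<theta>0 \<theta>1 \<alpha>err \<beta>err \<gamma> :: real and x :: obs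
  assumes DZ: "continuous_distribution DZ" and DY: "continuous_distribution DY"
  defines "M \<equiv> noise_space DZ DY"
  defines "\<tau> \<equiv> \<lambda>(z, y). ennreal_of_enat (fst (test_output
             (ell0 \<theta>0 \<theta>1 \<beta>err \<gamma> C) (ell1 \<theta>0 \<theta>1 \<alpha>err \<gamma> C) x z y))"
  shows "AE (z, y) in M.
           cond_exp_tau \<theta>0 \<theta>1 \<alpha>err \<beta>err \<gamma> C DY x z
           = nn_cond_exp M (vimage_algebra (space M) fst borel) \<tau> (z, y)"
proof -
  interpret DZ: prob_space DZ by (rule continuous_distributionD[OF DZ])
  interpret Q: prob_space "query_noise DY" by (rule prob_space_query_noise[OF DY])
  interpret pair_prob_space DZ "query_noise DY" ..
  let ?F = "vimage_algebra (space M) fst (borel :: real measure)"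
  let ?h = "cond_exp_tau \<theta>0 \<theta>1 \<alpha>err \<beta>err \<gamma> C DY x"
  have MP: "M = DZ \<Otimes>\<^sub>M query_noise DY" by (simp add: M_def noise_space_def)
  have fst_meas: "fst \<in> measurable M (borel :: real measure)"
    unfolding MP using measurable_fst[of DZ "query_noise DY"] continuous_distributionD(2)[OF DZ]
    by (simp cong: measurable_cong_sets)
  have \<tau>_meas [measurable]: "\<tau> \<in> borel_measurable M"
    using measurable_compose[OF measurable_test_output[OF DZ DY], of "\<lambda>p. ennreal_of_enat (fst p)" borel]
    by (simp add: M_def \<tau>_def case_prod_beta)
  have h_meas: "?h \<in> borel_measurable borel"
  proof -
    have "(\<lambda>z. \<integral>\<^sup>+ y. \<tau> (z, y) \<partial>query_noise DY) \<in> borel_measurable DZ"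
      using \<tau>_meas unfolding MP by measurable
    then show ?thesis
      using continuous_distributionD(2)[OF DZ]
      by (simp add: \<tau>_def cond_exp_tau_def[abs_def] cong: measurable_cong_sets)
  qed
  have sub: "subalgebra M ?F"
    using fst_meas by (auto simp: subalgebra_def sets_vimage_algebra2 measurable_sets space_vimage_algebra)
  interpret prob_space M unfolding M_def by (rule prob_space_noise_space[OF DZ DY])
  interpret finite_measure_subalgebra M ?F by unfold_locales (rule sub)
  interpret sigma_finite_subalgebra M ?F
    by (rule finite_measure_subalgebra_is_sigma_finite) unfold_locales
  have "AE w in M. ?h (fst w) = nn_cond_exp M ?F \<tau> w"
  proof (rule nn_cond_exp_charact)
    show "(\<lambda>w. ?h (fst w)) \<in> borel_measurable ?F"
      by (rule measurable_compose[OF measurable_vimage_algebra1 h_meas]) auto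
    fix A assume "A \<in> sets ?F"
    then obtain B where B: "B \<in> sets (borel :: real measure)" and A: "A = fst -` B \<inter> space M"
      by (auto simp: sets_vimage_algebra2)
    have ind: "indicator A w = (indicator B (fst w) :: ennreal)" if "w \<in> space M" for w
      using that by (auto simp: A indicator_def)
    have B': "(indicator B :: real \<Rightarrow> ennreal) \<in> borel_measurable DZ"
      using B continuous_distributionD(2)[OF DZ] by simp
    have h': "?h \<in> borel_measurable DZ"
      using h_meas continuous_distributionD(2)[OF DZ] by (simp cong: measurable_cong_sets)
    have "(\<integral>\<^sup>+ w\<in>A. \<tau> w \<partial>M) = (\<integral>\<^sup>+ w. \<tau> w * indicator B (fst w) \<partial>M)"
      by (intro nn_integral_cong) (simp add: ind)
    also have "\<dots> = (\<integral>\<^sup>+ z. \<integral>\<^sup>+ y. \<tau> (z, y) * indicator B z \<partial>query_noise DY \<partial>DZ)"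
      unfolding MP using \<tau>_meas[unfolded MP] B'
      by (subst Q.nn_integral_fst[symmetric]) (auto intro!: borel_measurable_times_ennreal measurable_compose[OF measurable_fst])
    also have "\<dots> = (\<integral>\<^sup>+ z. ?h z * indicator B z \<partial>DZ)"
    proof (rule nn_integral_cong)
      fix z assume z: "z \<in> space DZ"
      have "(\<lambda>y. \<tau> (z, y)) \<in> borel_measurable (query_noise DY)"
        using \<tau>_meas[unfolded MP] z by (rule measurable_Pair2)
      then show "(\<integral>\<^sup>+ y. \<tau> (z, y) * indicator B z \<partial>query_noise DY) = ?h z * indicator B z"
        by (simp add: nn_integral_multc \<tau>_def cond_exp_tau_def)
    qed
    also have "\<dots> = (\<integral>\<^sup>+ z. \<integral>\<^sup>+ y. ?h z * indicator B z \<partial>query_noise DY \<partial>DZ)"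
      by (simp add: Q.emeasure_space_1)
    also have "\<dots> = (\<integral>\<^sup>+ w. ?h (fst w) * indicator B (fst w) \<partial>M)"
      unfolding MP using B' h'
      by (subst Q.nn_integral_fst[symmetric]) (auto intro!: borel_measurable_times_ennreal measurable_compose[OF measurable_fst])
    also have "\<dots> = (\<integral>\<^sup>+ w\<in>A. ?h (fst w) \<partial>M)"
      by (intro nn_integral_cong) (simp add: ind)
    finally show "(\<integral>\<^sup>+ w\<in>A. \<tau> w \<partial>M) = (\<integral>\<^sup>+ w\<in>A. ?h (fst w) \<partial>M)" .
  qed (rule \<tau>_meas)
  then show ?thesis by (simp add: case_prod_beta)
qed

end

theory Submission
  imports Defs
begin

text \<open>
  Couple a run on \<open>x\<close> with noise \<open>z - 1\<close> with a run on \<open>x'\<close> with noise \<open>z\<close>: raising \<open>Z\<close> by \<open>1\<close> widens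
  the continuation region enough to absorb any change of one observation, and the region of the
  final decision is recovered by shifting the last query noise by at most \<open>2\<close>. Part (i) follows
  by paying for the two shifts.

  For part (ii), the rounds before the altered observation have the same output probabilities under
  both inputs. In every later round the partial sums differ by exactly \<open>1\<close>, so one of the two
  decisions needs no shift of the query noise at all and the other one a shift by \<open>2\<close>; as the two
  acceptance regions are disjoint, both together cost at most \<open>sqrt 2\<close> times, rather than twice, the
  moment of the likelihood ratio of one shift. Summing the survival probabilities of the rounds
  gives the conditional expectation of \<open>\<tau>\<close> given \<open>Z\<close>, and the Cauchy--Schwarz inequality in \<open>z\<close>
  separates it from the likelihood ratio of \<open>Z\<close>.
\<close>

section \<open>Shifted noise\<close>

lemma noise_mech_0:
  assumes "continuous_distribution D" "f x = 0"
  shows "noise_mech D f x = D"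
  using continuous_distributionD(2)[OF assms(1)] by (simp add: noise_mech_def assms(2) distr_id2)

text \<open>Privacy speaks of queries on neighboring data, whereas the argument needs translates of
  the noise. A multiple of one observation realizes every translate up to \<open>\<Delta>\<close>,
  and its value 0 at the second input leaves the noise itself there.\<close>

lemma shift_query:
  fixes s \<Delta> :: real
  assumes "\<bar>s\<bar> \<le> \<Delta>"
  obtains f x x' where "has_sensitivity f \<Delta>" "neighboring x x'" "f x = s" "f x' = 0"
proof
  show "has_sensitivity (\<lambda>x. s * of_bool (x 0)) \<Delta>"
    using assms by (auto simp: has_sensitivity_def of_bool_def)
  show "neighboring (\<lambda>i. i = 0) (\<lambda>_. False)"
    by (auto simp: neighboring_def)
qed auto

lemma prob_space_shift:
  assumes "continuous_distribution D"
  shows "prob_space (distr D borel (\<lambda>w. s + w))"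
  using continuous_distributionD[OF assms]
  by (intro prob_space.prob_space_distr) (simp_all cong: measurable_cong_sets)

text \<open>Ordering the measures, rather than comparing single sets, lets the bound pass through
  integrals over the noise as well.\<close>

lemma dp_shift:
  assumes D: "continuous_distribution D" and s: "\<bar>s\<bar> \<le> \<Delta>"
    and dp: "\<And>f. has_sensitivity f \<Delta> \<Longrightarrow> dp \<epsilon> (noise_mech D f)"
  shows "distr D borel (\<lambda>w. s + w) \<le> scale_measure (ennreal (exp \<epsilon>)) D"
proof -
  obtain f x x' where f: "has_sensitivity f \<Delta>" "neighboring x x'" "f x = s" "f x' = 0"
    by (rule shift_query[OF s])
  interpret D: prob_space D by (rule continuous_distributionD[OF D])
  interpret S: prob_space "distr D borel (\<lambda>w. s + w)" by (rule prob_space_shift[OF D])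
  have "measure (distr D borel (\<lambda>w. s + w)) A \<le> exp \<epsilon> * measure D A" if "A \<in> sets borel" for A
  proof -
    have "noise_mech D f x = distr D borel (\<lambda>w. s + w)" by (simp add: noise_mech_def f(3))
    then show ?thesis
      using dp[OF f(1)] f(2) that noise_mech_0[of D f x', OF D f(4)]
      by (metis dp_def sets_distr)
  qed
  then show ?thesis
    using continuous_distributionD[OF D]
    by (subst le_measure) (auto simp: S.emeasure_eq_measure D.emeasure_eq_measure
        ennreal_mult[symmetric] intro!: ennreal_leI)
qed

lemma ln_ennreal_le_ereal:
  assumes "ln_ennreal x \<le> ereal c"
  shows "x \<le> ennreal (exp c)"
proof (cases x)
  case (real r)
  show ?thesis
  proof (cases "r = 0")
    case False
    then have "ln r \<le> c" using assms real by (simp add: ln_ennreal_def)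
    then have "r \<le> exp c" using False real by (metis exp_le_cancel_iff exp_ln less_eq_real_def)
    then show ?thesis using real by (simp add: ennreal_leI)
  qed (use real in simp)
qed (use assms in \<open>simp add: ln_ennreal_def\<close>)

text \<open>\<open>\<rho>\<close> is a version of the likelihood ratio of \<open>s + W\<close>
  against \<open>W\<close>, with \<open>W\<close> distributed as \<open>D\<close>. It is
  characterized by a change of variables, the form in which shifts are made under an integral, and
  is real-valued so that its powers need no treatment of \<open>\<infinity>\<close>.\<close>

definition shift_density :: "real measure \<Rightarrow> real \<Rightarrow> (real \<Rightarrow> real) \<Rightarrow> bool" where
  "shift_density D s \<rho> \<longleftrightarrow> \<rho> \<in> borel_measurable borel \<and> (\<forall>w. 0 \<le> \<rho> w) \<and>
     (\<forall>g \<in> borel_measurable borel. (\<integral>\<^sup>+ w. g (s + w) \<partial>D) = (\<integral>\<^sup>+ w. ennreal (\<rho> w) * g w \<partial>D))"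

lemma shift_densityD:
  assumes "shift_density D s \<rho>"
  shows "\<rho> \<in> borel_measurable borel" and "0 \<le> \<rho> w"
  using assms unfolding shift_density_def by blast+

lemma shift_density_total:
  assumes "prob_space D" and \<rho>: "shift_density D s \<rho>"
  shows "(\<integral>\<^sup>+ w. ennreal (\<rho> w) \<partial>D) = 1"
proof -
  interpret prob_space D by fact
  have "\<forall>g \<in> borel_measurable borel. (\<integral>\<^sup>+ w. g (s + w) \<partial>D) = (\<integral>\<^sup>+ w. ennreal (\<rho> w) * g w \<partial>D)"
    using \<rho> unfolding shift_density_def by (elim conjE)
  from bspec[OF this, of "\<lambda>_. 1"] show ?thesis by (simp add: emeasure_space_1)
qed

lemma rdp_shift_density:
  assumes D: "continuous_distribution D" and s: "\<bar>s\<bar> \<le> \<Delta>" and \<alpha>: "1 < \<alpha>"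
    and rdp: "\<And>f. has_sensitivity f \<Delta> \<Longrightarrow> rdp \<alpha> \<epsilon> (noise_mech D f)"
  obtains \<rho> where "shift_density D s \<rho>"
    "(\<integral>\<^sup>+ w. ennreal (\<rho> w powr \<alpha>) \<partial>D) \<le> ennreal (exp ((\<alpha> - 1) * \<epsilon>))"
proof -
  obtain f x x' where f: "has_sensitivity f \<Delta>" "neighboring x x'" "f x = s" "f x' = 0"
    by (rule shift_query[OF s])
  note Db [measurable_cong] = continuous_distributionD(2)[OF D]
  interpret D: prob_space D by (rule continuous_distributionD[OF D])
  let ?S = "distr D borel (\<lambda>w. s + w)"
  interpret S: prob_space ?S by (rule prob_space_shift[OF D])
  have le: "renyi_div \<alpha> ?S D \<le> ereal \<epsilon>"
  proof -
    have "noise_mech D f x = ?S" by (simp add: noise_mech_def f(3))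
    then show ?thesis
      using rdp[OF f(1)] f(2) noise_mech_0[of D f x', OF D f(4)] by (metis rdp_def)
  qed
  \<comment> \<open>The divergence is \<open>\<infinity>\<close> without absolute continuity, so a
    finite bound forces it.\<close>
  then have ac: "absolutely_continuous D ?S"
    by (auto simp: renyi_div_def split: if_splits)
  let ?\<rho> = "\<lambda>w. enn2real (RN_deriv D ?S w)"
  \<comment> \<open>Almost everywhere finiteness makes \<open>enn2real\<close> harmless in the
    change of variables.\<close>
  have fin: "AE w in D. RN_deriv D ?S w \<noteq> \<infinity>"
    by (rule D.RN_deriv_finite[OF S.sigma_finite_measure_axioms ac]) (simp add: Db)
  have "ereal (1 / (\<alpha> - 1)) * ln_ennreal (\<integral>\<^sup>+ w. ennreal (?\<rho> w powr \<alpha>) \<partial>D) \<le> ereal \<epsilon>"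
    using le ac by (simp add: renyi_div_def)
  then have "ln_ennreal (\<integral>\<^sup>+ w. ennreal (?\<rho> w powr \<alpha>) \<partial>D) \<le> ereal ((\<alpha> - 1) * \<epsilon>)"
    using \<alpha> by (cases "ln_ennreal (\<integral>\<^sup>+ w. ennreal (?\<rho> w powr \<alpha>) \<partial>D)") (auto simp: field_simps)
  note bound = ln_ennreal_le_ereal[OF this]
  have "shift_density D s ?\<rho>"
    unfolding shift_density_def
  proof (intro conjI ballI allI)
    fix g :: "real \<Rightarrow> ennreal" assume [measurable]: "g \<in> borel_measurable borel"
    have "(\<integral>\<^sup>+ w. g (s + w) \<partial>D) = (\<integral>\<^sup>+ w. g w \<partial>?S)"
      by (subst nn_integral_distr) auto
    also have "\<dots> = (\<integral>\<^sup>+ w. RN_deriv D ?S w * g w \<partial>D)"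
      by (rule D.RN_deriv_nn_integral[OF ac]) (simp_all add: Db)
    also have "\<dots> = (\<integral>\<^sup>+ w. ennreal (?\<rho> w) * g w \<partial>D)"
      using fin by (intro nn_integral_cong_AE) (auto simp: less_top)
    finally show "(\<integral>\<^sup>+ w. g (s + w) \<partial>D) = (\<integral>\<^sup>+ w. ennreal (?\<rho> w) * g w \<partial>D)" .
  qed auto
  then show ?thesis using bound by (rule that)
qed

section \<open>Moments of likelihood ratios\<close>

text \<open>The tangent inequality of \<open>x powr \<alpha> * q powr (1 - \<alpha>)\<close> at \<open>q = 1\<close>, with \<open>w\<close> the point of
  contact. It replaces Hoelder's inequality and avoids dividing by probabilities that may vanish.\<close>

lemma powr_tangent:
  fixes x w \<alpha> :: real
  assumes "0 \<le> x" "0 \<le> w" "1 < \<alpha>"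
  shows "\<alpha> * w powr (\<alpha> - 1) * x \<le> x powr \<alpha> + (\<alpha> - 1) * w powr \<alpha>"
proof -
  have "x * (w powr (\<alpha> - 1)) \<le> x powr \<alpha> / \<alpha> + (w powr (\<alpha> - 1)) powr (\<alpha> / (\<alpha> - 1)) / (\<alpha> / (\<alpha> - 1))"
    by (rule Youngs_inequality) (use assms in \<open>auto simp: field_simps\<close>)
  also have "(w powr (\<alpha> - 1)) powr (\<alpha> / (\<alpha> - 1)) = w powr \<alpha>"
    using assms by (simp add: powr_powr)
  finally have "\<alpha> * (x * (w powr (\<alpha> - 1))) \<le> \<alpha> * (x powr \<alpha> / \<alpha> + w powr \<alpha> / (\<alpha> / (\<alpha> - 1)))"
    by (rule mult_left_mono) (use assms in simp)
  also have "\<dots> = x powr \<alpha> + (\<alpha> - 1) * w powr \<alpha>"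
    using assms by (simp add: distrib_left)
  finally show ?thesis by (simp add: mult_ac)
qed

lemma exp_1_ge: "1 + sqrt 2 \<le> exp (1 :: real)"
proof -
  have "(1 :: real) + 1 + 1 / 2 \<le> exp 1"
    using exp_lower_Taylor_quadratic[of 1] by simp
  moreover have "sqrt 2 \<le> 3 / 2"
    by (rule real_le_lsqrt) (auto simp: power2_eq_square)
  ultimately show ?thesis by simp
qed

text \<open>Since \<open>ln (r powr (\<alpha> - 1)) \<le> r powr (\<alpha> - 1) / exp 1\<close> and \<open>1 / exp 1 \<le> sqrt 2 - 1\<close>.\<close>

lemma powr_excess:
  fixes r \<alpha> :: real
  assumes "0 \<le> r" "1 < \<alpha>"
  shows "(\<alpha> - 1) * r \<le> (sqrt 2 - 1) * r powr \<alpha> + (\<alpha> - 1)"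
proof (cases "r = 0")
  case False
  define t where "t = r powr (\<alpha> - 1)"
  have r: "r > 0" and t: "t > 0" using False assms by (auto simp: t_def)
  have "ln t \<le> (sqrt 2 - 1) * t"
  proof -
    have "ln t = ln (t / exp 1) + 1" using t by (simp add: ln_div)
    also have "\<dots> \<le> t / exp 1" using ln_le_minus_one[of "t / exp 1"] t by simp
    also have "\<dots> = t * (1 / exp 1)" by simp
    also have "\<dots> \<le> t * (sqrt 2 - 1)"
    proof (rule mult_left_mono)
      have "1 = (sqrt 2 - 1) * (1 + sqrt 2)" by (simp add: algebra_simps)
      also have "\<dots> \<le> (sqrt 2 - 1) * exp 1" by (intro mult_left_mono exp_1_ge) simp
      finally show "1 / exp 1 \<le> sqrt 2 - 1" by (simp add: divide_le_eq)
    qed (use t in simp)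
    finally show ?thesis by (simp add: mult.commute)
  qed
  moreover have "ln t = (\<alpha> - 1) * ln r" using r by (simp add: t_def ln_powr)
  \<comment> \<open>From \<open>1 - 1 / r \<le> ln r\<close>; multiplied by \<open>r\<close>, it
    links the bound on \<open>ln t\<close> to the linear term of the claim.\<close>
  moreover have "(\<alpha> - 1) * (1 - 1 / r) \<le> (\<alpha> - 1) * ln r"
    using ln_le_minus_one[of "1 / r"] r assms by (intro mult_left_mono) (auto simp: ln_div)
  ultimately have "(\<alpha> - 1) * (1 - 1 / r) * r \<le> (sqrt 2 - 1) * t * r"
    using r by (intro mult_right_mono) auto
  moreover have "t * r = r powr \<alpha>" using r by (simp add: t_def powr_diff)
  moreover have "(\<alpha> - 1) * (1 - 1 / r) * r = (\<alpha> - 1) * r - (\<alpha> - 1)"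
    using r by (simp add: field_simps)
  ultimately show ?thesis by (simp add: mult.assoc)
qed (use assms in simp)

text \<open>This is where the factor \<open>sqrt 2\<close> arises: \<open>r\<close> is the likelihood ratio of the shifted noise, \<open>B\<close>
  the acceptance region reached by the shift, and the second integral bounds the probability of the
  decision that needs no shift.\<close>

lemma split_moment_bound:
  fixes r :: "'a \<Rightarrow> real"
  assumes D: "prob_space D" and r [measurable]: "r \<in> borel_measurable D" and r0: "\<And>y. 0 \<le> r y"
    and int: "(\<integral>\<^sup>+ y. ennreal (r y) \<partial>D) = 1" and \<alpha>: "1 < \<alpha>"
    and B [measurable]: "B \<in> sets D"
  shows "(\<integral>\<^sup>+ y. ennreal (r y powr \<alpha>) * indicator B y \<partial>D)
      + (\<integral>\<^sup>+ y. ennreal (r y) * indicator (space D - B) y \<partial>D)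
    \<le> ennreal (sqrt 2) * (\<integral>\<^sup>+ y. ennreal (r y powr \<alpha>) \<partial>D)" (is "?U + ?V \<le> _ * ?E")
proof -
  interpret prob_space D by (rule D)
  \<comment> \<open>Inside \<open>B\<close> this is \<open>powr_excess\<close>, outside it is
    \<open>powr_tangent\<close> with contact point 1. The term \<open>(\<alpha> - 1) * r y\<close>
    is added because it integrates to \<open>\<alpha> - 1\<close>, which then cancels against the
    constant on the right.\<close>
  have pt: "ennreal (r y powr \<alpha>) * indicator B y + ennreal (r y) * indicator (space D - B) y
      + ennreal (\<alpha> - 1) * ennreal (r y) \<le> ennreal (sqrt 2) * ennreal (r y powr \<alpha>) + ennreal (\<alpha> - 1)"
    if "y \<in> space D" for y
  proof -
    have 1: "r y powr \<alpha> + (\<alpha> - 1) * r y \<le> sqrt 2 * r y powr \<alpha> + (\<alpha> - 1)"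
      using powr_excess[OF r0[of y] \<alpha>] by (simp add: algebra_simps)
    have "1 * r y powr \<alpha> \<le> sqrt 2 * r y powr \<alpha>" by (intro mult_right_mono) auto
    then have 2: "r y + (\<alpha> - 1) * r y \<le> sqrt 2 * r y powr \<alpha> + (\<alpha> - 1)"
      using powr_tangent[OF r0[of y] _ \<alpha>, of 1] by (simp add: algebra_simps)
    show ?thesis
      using 1 2 that r0[of y] \<alpha>
      by (cases "y \<in> B") (simp_all add: ennreal_plus[symmetric] ennreal_mult[symmetric] ennreal_leI
          del: ennreal_plus)
  qed
  have "?U + ?V + ennreal (\<alpha> - 1) * (\<integral>\<^sup>+ y. ennreal (r y) \<partial>D)
    = (\<integral>\<^sup>+ y. ennreal (r y powr \<alpha>) * indicator B y + ennreal (r y) * indicator (space D - B) y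
      + ennreal (\<alpha> - 1) * ennreal (r y) \<partial>D)"
    by (simp add: nn_integral_add nn_integral_cmult)
  also have "\<dots> \<le> (\<integral>\<^sup>+ y. ennreal (sqrt 2) * ennreal (r y powr \<alpha>) + ennreal (\<alpha> - 1) \<partial>D)"
    by (intro nn_integral_mono pt)
  also have "\<dots> = ennreal (sqrt 2) * ?E + ennreal (\<alpha> - 1)"
    by (simp add: nn_integral_add nn_integral_cmult emeasure_space_1)
  finally show ?thesis unfolding int by (simp add: ennreal_add_left_cancel_le add.commute)
qed

text \<open>Jensen's inequality for the power \<open>\<alpha>\<close>, by integrating the tangent at
  1.\<close>

lemma one_le_moment:
  fixes r :: "'a \<Rightarrow> real"
  assumes D: "prob_space D" and r [measurable]: "r \<in> borel_measurable D" and r0: "\<And>y. 0 \<le> r y"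
    and int: "(\<integral>\<^sup>+ y. ennreal (r y) \<partial>D) = 1" and \<alpha>: "1 < \<alpha>"
  shows "1 \<le> (\<integral>\<^sup>+ y. ennreal (r y powr \<alpha>) \<partial>D)"
proof -
  interpret prob_space D by (rule D)
  have "1 + ennreal (\<alpha> - 1) = ennreal \<alpha>"
    using \<alpha> by (subst ennreal_1[symmetric], subst ennreal_plus[symmetric]) auto
  also have "\<dots> = (\<integral>\<^sup>+ y. ennreal \<alpha> * ennreal (r y) \<partial>D)"
    by (simp add: nn_integral_cmult int)
  also have "\<dots> \<le> (\<integral>\<^sup>+ y. ennreal (r y powr \<alpha>) + ennreal (\<alpha> - 1) \<partial>D)"
    using powr_tangent[OF r0 _ \<alpha>, of 1] \<alpha> r0
    by (intro nn_integral_mono)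
      (simp add: ennreal_plus[symmetric] ennreal_mult[symmetric] ennreal_leI del: ennreal_plus)
  also have "\<dots> = (\<integral>\<^sup>+ y. ennreal (r y powr \<alpha>) \<partial>D) + ennreal (\<alpha> - 1)"
    by (simp add: nn_integral_add emeasure_space_1)
  finally show ?thesis by simp
qed

text \<open>At the likelihood ratio of the outputs, the same moment \<open>a\<close> appears on both
  sides of the tangent inequality, with factors \<open>\<alpha>\<close> and
  \<open>\<alpha> - 1\<close>. Finiteness of \<open>a\<close> is what allows the
  cancellation.\<close>

lemma ennreal_le_of_scaled:
  fixes a h :: ennreal
  assumes le: "ennreal \<alpha> * a \<le> h + ennreal (\<alpha> - 1) * a" and \<alpha>: "1 < \<alpha>" and a: "a \<noteq> \<top>"
  shows "a \<le> h"
proof -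
  have "ennreal \<alpha> = 1 + ennreal (\<alpha> - 1)"
    using \<alpha> by (subst ennreal_1[symmetric], subst ennreal_plus[symmetric]) auto
  then have "a + ennreal (\<alpha> - 1) * a \<le> h + ennreal (\<alpha> - 1) * a"
    using le by (simp add: distrib_right)
  moreover have "ennreal (\<alpha> - 1) * a \<noteq> \<top>"
    using a by (simp add: ennreal_mult_eq_top_iff)
  ultimately show ?thesis by (simp add: add.commute)
qed

text \<open>\<open>X\<close> is the divergence integral, \<open>K\<close> the total cost,
  \<open>E\<close> the moment bound for the query noise, \<open>M\<close> the moment of order
  \<open>2 * \<alpha>\<close> of the ratio for \<open>Z\<close>, and \<open>J\<close> the second
  moment of the conditional expected stopping time. The logarithm of the squared bound is divided by
  \<open>2 * (\<alpha> - 1)\<close>, which produces the halves in the claim.\<close>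

lemma renyi_bound_arith:
  fixes X K E M J :: ennreal
  assumes X: "X \<le> K" and K: "K\<^sup>2 \<le> 2 * E\<^sup>2 * (M * J)"
    and E: "E = ennreal (exp ((\<alpha> - 1) * \<epsilon>Y))" and M: "M \<le> ennreal (exp ((2 * \<alpha> - 1) * \<epsilon>Z))"
    and J: "1 \<le> J" "J \<noteq> \<top>" and \<alpha>: "1 < \<alpha>"
  shows "ereal (1 / (\<alpha> - 1)) * ln_ennreal X
    \<le> ereal ((\<alpha> - 1 / 2) / (\<alpha> - 1) * \<epsilon>Z) + ereal \<epsilon>Y + ln_ennreal (2 * J) / ereal (2 * (\<alpha> - 1))"
proof (cases "X = 0")
  case True
  then show ?thesis using \<alpha> by (simp add: ln_ennreal_def)
next
  case False
  obtain j where j: "J = ennreal j" "1 \<le> j"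
    using J by (cases J) (auto simp: ennreal_1[symmetric] simp del: ennreal_1)
  let ?B = "2 * (exp ((\<alpha> - 1) * \<epsilon>Y))\<^sup>2 * (exp ((2 * \<alpha> - 1) * \<epsilon>Z) * j)"
  have "X\<^sup>2 \<le> K\<^sup>2" using X by (simp add: power_mono)
  also have "\<dots> \<le> 2 * E\<^sup>2 * (M * J)" by (rule K)
  also have "\<dots> \<le> 2 * E\<^sup>2 * (ennreal (exp ((2 * \<alpha> - 1) * \<epsilon>Z)) * J)"
    by (intro mult_left_mono mult_right_mono M) auto
  also have "\<dots> = ennreal ?B"
    using j by (simp add: E ennreal_mult ennreal_power)
  finally have X2: "X\<^sup>2 \<le> ennreal ?B" .
  then have "X \<noteq> \<top>" by (auto simp: top_unique power2_eq_square ennreal_mult_eq_top_iff)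
  then obtain y where y: "X = ennreal y" "0 < y"
    using False by (cases X) (auto simp: less_le)
  have "y\<^sup>2 \<le> ?B"
    using X2 y j by (simp add: ennreal_power)
  then have "ln (y\<^sup>2) \<le> ln ?B"
    using y j by (subst ln_le_cancel_iff) auto
  also have "ln ?B = ln (2 * j) + 2 * ((\<alpha> - 1) * \<epsilon>Y) + (2 * \<alpha> - 1) * \<epsilon>Z"
    using j by (simp add: ln_mult ln_realpow)
  finally have "2 * ln y \<le> ln (2 * j) + 2 * ((\<alpha> - 1) * \<epsilon>Y) + (2 * \<alpha> - 1) * \<epsilon>Z"
    using y by (simp add: ln_realpow)
  then have le: "2 * ln y / (2 * (\<alpha> - 1))
      \<le> (ln (2 * j) + 2 * ((\<alpha> - 1) * \<epsilon>Y) + (2 * \<alpha> - 1) * \<epsilon>Z) / (2 * (\<alpha> - 1))"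
    using \<alpha> by (intro divide_right_mono) auto
  have "ln y / (\<alpha> - 1) = 2 * ln y / (2 * (\<alpha> - 1))"
    by (rule mult_divide_mult_cancel_left[symmetric]) simp
  also note le
  also have "(ln (2 * j) + 2 * ((\<alpha> - 1) * \<epsilon>Y) + (2 * \<alpha> - 1) * \<epsilon>Z) / (2 * (\<alpha> - 1))
    = (\<alpha> - 1 / 2) / (\<alpha> - 1) * \<epsilon>Z + \<epsilon>Y + ln (2 * j) / (2 * (\<alpha> - 1))"
  proof -
    have "2 * ((\<alpha> - 1) * \<epsilon>Y) / (2 * (\<alpha> - 1)) = \<epsilon>Y" using \<alpha> by (simp add: divide_simps)
    moreover have "(2 * \<alpha> - 1) * \<epsilon>Z / (2 * (\<alpha> - 1)) = (\<alpha> - 1 / 2) / (\<alpha> - 1) * \<epsilon>Z"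
      using \<alpha> by (simp add: divide_simps)
    ultimately show ?thesis by (simp only: add_divide_distrib add_ac)
  qed
  finally have "ln y / (\<alpha> - 1) \<le> (\<alpha> - 1 / 2) / (\<alpha> - 1) * \<epsilon>Z + \<epsilon>Y + ln (2 * j) / (2 * (\<alpha> - 1))" .
  moreover have "ln_ennreal X = ereal (ln y)" using y by (simp add: ln_ennreal_def)
  moreover have "ln_ennreal (2 * J) = ereal (ln (2 * j))"
  proof -
    have "2 * J = ennreal (2 * j)" using j by (simp add: ennreal_mult)
    then show ?thesis using j by (simp add: ln_ennreal_def)
  qed
  ultimately show ?thesis using \<alpha> by simp
qed

section \<open>Point masses and null sets on countable output spaces\<close>

lemma (in sigma_finite_measure) countable_RN_deriv:
  assumes ac: "absolutely_continuous M N" and M: "sets M = UNIV" and N: "prob_space N" "sets N = UNIV"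
  shows "emeasure N {q} = ennreal (enn2real (RN_deriv M N q)) * emeasure M {q}"
proof -
  interpret N: prob_space N by (rule N)
  have eq: "emeasure N {q} = RN_deriv M N q * emeasure M {q}"
    by (rule RN_deriv_singleton[OF ac]) (simp_all add: M N)
  show ?thesis
  proof (cases "emeasure M {q} = 0")
    case False
    \<comment> \<open>An infinite derivative at a point of positive mass would give \<open>N\<close>
      infinite mass there.\<close>
    have "RN_deriv M N q \<noteq> \<top>"
    proof
      assume "RN_deriv M N q = \<top>"
      then have "emeasure N {q} = \<top>" using eq False by (simp add: ennreal_top_mult)
      then show False by simp
    qed
    then show ?thesis by (simp add: eq less_top)
  qed (simp add: eq)
qed

text \<open>With this, absolute continuity of output laws only has to be checked at single
  outputs.\<close>

lemma countable_null_setsI: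
  fixes M :: "'b :: countable measure"
  assumes M: "sets M = UNIV" and A: "\<And>q. q \<in> A \<Longrightarrow> emeasure M {q} = 0"
  shows "A \<in> null_sets M"
proof -
  have "(\<Union>q\<in>A. {q}) \<in> null_sets M"
    by (intro null_sets_UN') (use M A in \<open>auto simp: null_sets_def\<close>)
  then show ?thesis by simp
qed

lemma null_sets_singleton:
  assumes "A \<in> null_sets M" "sets M = UNIV" "q \<in> A"
  shows "emeasure M {q} = 0"
proof -
  have "{q} \<in> null_sets M"
    by (rule null_sets_subset[OF assms(1)]) (use assms in auto)
  then show ?thesis by (simp add: null_sets_def)
qed

section \<open>Acceptance and continuation regions\<close>

text \<open>The sum rather than the mean: one changed observation moves it by 0 or 1, independently
  of the scale \<open>n\<close>.\<close>

definition obs_sum :: "obs \<Rightarrow> nat \<Rightarrow> real" where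
  "obs_sum x n = (\<Sum>i<n. of_bool (x i))"

text \<open>Removing \<open>A\<close> for decision 1 encodes the order of the checks, so that ties
  go to 0.\<close>

definition accept ::
  "(nat \<Rightarrow> real) \<Rightarrow> (nat \<Rightarrow> real) \<Rightarrow> obs \<Rightarrow> real \<Rightarrow> nat \<Rightarrow> nat \<Rightarrow> real set" where
  "accept l0 l1 x z n d =
     (let A = {y. obs_mean x n + y / real n \<le> l0 n - z / real n} in
      if d = 0 then A else {y. obs_mean x n + y / real n \<ge> l1 n + z / real n} - A)"

definition continue ::
  "(nat \<Rightarrow> real) \<Rightarrow> (nat \<Rightarrow> real) \<Rightarrow> obs \<Rightarrow> real \<Rightarrow> nat \<Rightarrow> real set" where
  "continue l0 l1 x z n = - (accept l0 l1 x z n 0 \<union> accept l0 l1 x z n 1)"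

lemma accept_0_iff:
  assumes "1 \<le> n"
  shows "y \<in> accept l0 l1 x z n 0 \<longleftrightarrow> obs_sum x n + y + z \<le> real n * l0 n"
proof -
  have "y \<in> accept l0 l1 x z n 0 \<longleftrightarrow> (obs_sum x n + y + z) / real n \<le> l0 n"
    by (simp add: accept_def obs_mean_def obs_sum_def add_divide_distrib le_diff_eq)
  then show ?thesis using assms by (simp add: pos_divide_le_eq mult.commute)
qed

lemma accept_1_iff:
  assumes "1 \<le> n"
  shows "y \<in> accept l0 l1 x z n (Suc 0) \<longleftrightarrow>
     real n * l1 n + z \<le> obs_sum x n + y \<and> real n * l0 n < obs_sum x n + y + z"
proof -
  have "y \<in> accept l0 l1 x z n (Suc 0) \<longleftrightarrow>
      l1 n \<le> (obs_sum x n + y - z) / real n \<and> y \<notin> accept l0 l1 x z n 0"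
    by (simp add: accept_def obs_mean_def obs_sum_def add_divide_distrib diff_divide_distrib le_diff_eq)
  also have "\<dots> \<longleftrightarrow> real n * l1 n + z \<le> obs_sum x n + y \<and> real n * l0 n < obs_sum x n + y + z"
    unfolding accept_0_iff[OF assms]
    using assms by (auto simp: pos_le_divide_eq mult.commute le_diff_eq)
  finally show ?thesis .
qed

lemma accept_disjoint: "accept l0 l1 x z n 0 \<inter> accept l0 l1 x z n 1 = {}"
  by (auto simp: accept_def Let_def)

lemma accept_borel [measurable]: "accept l0 l1 x z n d \<in> sets borel"
  by (cases "d = 0") (simp_all add: accept_def)

lemma continue_borel [measurable]: "continue l0 l1 x z n \<in> sets borel"
  unfolding continue_def by (intro borel_comp sets.Un accept_borel)

lemma accept_cong:
  assumes "\<And>i. i < n \<Longrightarrow> x i = x' i"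
  shows "accept l0 l1 x z n d = accept l0 l1 x' z n d"
proof -
  have "obs_mean x n = obs_mean x' n"
    unfolding obs_mean_def using assms by (intro arg_cong2[where f = "(/)"] sum.cong) auto
  then show ?thesis by (simp only: accept_def)
qed

lemma continue_cong:
  "(\<And>i. i < n \<Longrightarrow> x i = x' i) \<Longrightarrow> continue l0 l1 x z n = continue l0 l1 x' z n"
  unfolding continue_def using accept_cong[of n x x'] by simp

text \<open>On the scale of sums, replacing \<open>z - 1\<close> by \<open>z\<close> moves each
  threshold outwards by 1, which is at least the distance of the two sums.\<close>

lemma continue_mono:
  assumes "\<bar>obs_sum x n - obs_sum x' n\<bar> \<le> 1" "1 \<le> n"
  shows "continue l0 l1 x (z - 1) n \<subseteq> continue l0 l1 x' z n"
  using assms by (auto simp: continue_def accept_0_iff accept_1_iff)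

lemma accept_shift:
  assumes "\<bar>obs_sum x n - obs_sum x' n\<bar> \<le> 1" "1 \<le> n" "d \<in> {0, 1}"
  obtains s where "\<bar>s\<bar> \<le> 2"
    "\<And>y. y \<in> accept l0 l1 x (z - 1) n d \<Longrightarrow> s + y \<in> accept l0 l1 x' z n d"
proof (cases "d = 0")
  case True
  show ?thesis
    \<comment> \<open>With this shift the condition for decision 0 is the same inequality for both
      inputs; the 1 comes from the change of \<open>z\<close>.\<close>
    by (rule that[of "obs_sum x n - obs_sum x' n - 1"])
      (use assms True in \<open>auto simp: accept_0_iff\<close>)
next
  case False
  then have "d = Suc 0" using assms by simp
  show ?thesis
    \<comment> \<open>\<open>Z\<close> enters the upper threshold with the opposite sign, hence
      \<open>+ 1\<close>; the exclusion of decision 0 only gains slack.\<close>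
    by (rule that[of "obs_sum x n - obs_sum x' n + 1"])
      (use assms \<open>d = Suc 0\<close> in \<open>auto simp: accept_1_iff\<close>)
qed

text \<open>A difference of exactly 1 in the sums cancels the unit change of \<open>z\<close> for
  decision \<open>e\<close> and doubles it for \<open>d\<close>. Which decision needs the shift
  depends only on the sign of the difference, so \<open>d\<close>, \<open>e\<close> and
  \<open>s\<close> are chosen before \<open>z\<close> and \<open>y\<close>.\<close>

lemma accept_one_sided_shift:
  assumes "\<bar>obs_sum x n - obs_sum x' n\<bar> = 1" "1 \<le> n"
  obtains d e s where "d \<in> {0, 1}" "e = 1 - d" "\<bar>s\<bar> \<le> 2"
    "\<And>z y. y \<in> accept l0 l1 x (z - 1) n d \<Longrightarrow> s + y \<in> accept l0 l1 x' z n d"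
    "\<And>z y. y \<in> accept l0 l1 x (z - 1) n e \<Longrightarrow> y \<in> accept l0 l1 x' z n e"
proof (cases "obs_sum x n - obs_sum x' n = 1")
  case True
  show ?thesis
    by (rule that[of 1 0 2]) (use assms True in \<open>auto simp: accept_0_iff accept_1_iff\<close>)
next
  case False
  then have "obs_sum x n - obs_sum x' n = - 1" using assms by linarith
  then show ?thesis
    by (intro that[of 0 1 "- 2"]) (use assms in \<open>auto simp: accept_0_iff accept_1_iff\<close>)
qed

lemma obs_sum_diff:
  assumes "\<And>i. i \<noteq> k \<Longrightarrow> x i = x' i"
  shows "obs_sum x n - obs_sum x' n = (if k < n then of_bool (x k) - of_bool (x' k) else 0)"
proof -
  have "obs_sum x n - obs_sum x' n
    = (\<Sum>i<n. if i = k then of_bool (x k) - of_bool (x' k) else 0)"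
    unfolding obs_sum_def sum_subtractf[symmetric] using assms by (intro sum.cong) auto
  also have "\<dots> = (if k < n then of_bool (x k) - of_bool (x' k) else 0)"
    by (subst sum.delta) auto
  finally show ?thesis .
qed

section \<open>Stopping times and decisions in terms of the regions\<close>

lemma enat_less_first_time_iff: "enat n < first_time P \<longleftrightarrow> (\<forall>m\<in>{1..n}. \<not> P m)"
  using first_time_le_iff[of P n] by (auto simp: not_le[symmetric])

lemma Suc_le_first_time_iff: "enat (Suc n) \<le> first_time P \<longleftrightarrow> (\<forall>m\<in>{1..n}. \<not> P m)"
  using enat_less_first_time_iff[of n P] by (simp add: Suc_ile_eq)

lemma first_time_eq_Suc_iff:
  "first_time P = enat (Suc n) \<longleftrightarrow> P (Suc n) \<and> (\<forall>m\<in>{1..n}. \<not> P m)"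
proof -
  have "first_time P = enat (Suc n) \<longleftrightarrow> first_time P \<le> enat (Suc n) \<and> enat (Suc n) \<le> first_time P"
    by auto
  then show ?thesis
    unfolding first_time_le_iff Suc_le_first_time_iff by (auto simp: atLeastAtMostSuc_conv)
qed

lemma less_fst_test_output_iff:
  "enat n < fst (test_output l0 l1 x z y) \<longleftrightarrow> (\<forall>m\<in>{1..n}. y m \<in> continue l0 l1 x z m)"
  unfolding test_output_def tau0_def tau1_def fst_conv min_less_iff_conj enat_less_first_time_iff
    continue_def accept_def
  by (auto simp: Let_def)

lemma test_output_eq_Suc_iff:
  assumes "d \<in> {0, 1}"
  shows "test_output l0 l1 x z y = (enat (Suc n), d) \<longleftrightarrow>
    y (Suc n) \<in> accept l0 l1 x z (Suc n) d \<and> (\<forall>m\<in>{1..n}. y m \<in> continue l0 l1 x z m)"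
proof -
  let ?P0 = "\<lambda>n. obs_mean x n + y n / real n \<le> l0 n - z / real n"
  let ?P1 = "\<lambda>n. obs_mean x n + y n / real n \<ge> l1 n + z / real n"
  \<comment> \<open>Decision 1 needs \<open>t < s\<close> strictly. This is split into
    \<open>enat (Suc n) \<le> s\<close> and \<open>s \<noteq> enat (Suc n)\<close>, the two forms in
    which first times are characterized.\<close>
  have 0: "min s t = enat (Suc n) \<and> (if s \<le> t then 0 else 1) = d \<longleftrightarrow>
      (if d = 0 then s = enat (Suc n) \<and> enat (Suc n) \<le> t
       else t = enat (Suc n) \<and> enat (Suc n) \<le> s \<and> s \<noteq> enat (Suc n))" for s t :: enat
    using assms by (auto simp: min_def)
  have "test_output l0 l1 x z y = (enat (Suc n), d) \<longleftrightarrow>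
      (if d = 0 then first_time ?P0 = enat (Suc n) \<and> enat (Suc n) \<le> first_time ?P1
       else first_time ?P1 = enat (Suc n) \<and> enat (Suc n) \<le> first_time ?P0
         \<and> first_time ?P0 \<noteq> enat (Suc n))"
    unfolding test_output_def prod.inject tau0_def[symmetric] tau1_def[symmetric] by (rule 0)
  also have "\<dots> \<longleftrightarrow> y (Suc n) \<in> accept l0 l1 x z (Suc n) d
      \<and> (\<forall>m\<in>{1..n}. y m \<in> continue l0 l1 x z m)"
    unfolding first_time_eq_Suc_iff Suc_le_first_time_iff continue_def accept_def
    by (auto simp: Let_def)
  finally show ?thesis .
qed

text \<open>Rounds start at 1, so a finite stopping time is a successor. If neither threshold is
  crossed, the infinite times tie and the decision defaults to 0.\<close>

lemma test_output_cases:
  obtains "test_output l0 l1 x z y = (\<infinity>, 0)"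
  | n d where "d \<in> {0, 1}" "test_output l0 l1 x z y = (enat (Suc n), d)"
proof -
  let ?t = "fst (test_output l0 l1 x z y)"
  have pos: "enat 0 < ?t" by (simp only: less_fst_test_output_iff) simp
  have d: "snd (test_output l0 l1 x z y) \<in> {0, 1}" by (simp add: test_output_def)
  show ?thesis
  proof (cases ?t)
    case (enat m)
    then obtain n where "m = Suc n" using pos by (cases m) auto
    then show ?thesis using that(2)[OF d, of n] enat by (metis prod.collapse)
  next
    case infinity
    then have "snd (test_output l0 l1 x z y) = 0"
      by (auto simp: test_output_def min_def split: if_splits)
    then show ?thesis using that(1) infinity by (metis prod.collapse)
  qed
qed

lemma fst_test_output_eq_infinity_iff:
  "fst (test_output l0 l1 x z y) = \<infinity> \<longleftrightarrow> test_output l0 l1 x z y = (\<infinity>, 0)"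
  by (cases rule: test_output_cases[of l0 l1 x z y]) auto

section \<open>The output distribution\<close>

locale noisy_test =
  fixes DZ DY :: "real measure" and l0 l1 :: "nat \<Rightarrow> real"
  assumes DZ: "continuous_distribution DZ" and DY: "continuous_distribution DY"
begin

sublocale Z: prob_space DZ by (rule continuous_distributionD[OF DZ])
sublocale Y: prob_space DY by (rule continuous_distributionD[OF DY])
sublocale Q: prob_space "query_noise DY" by (rule prob_space_query_noise[OF DY])
sublocale YS: product_prob_space "\<lambda>_. DY" "{1 :: nat..}" ..

lemma sets_Z [measurable_cong, simp]: "sets DZ = sets borel"
  and sets_Y [measurable_cong, simp]: "sets DY = sets borel"
  and space_Z [simp]: "space DZ = UNIV" and space_Y [simp]: "space DY = UNIV"
  using continuous_distributionD DZ DY by blast+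

definition out :: "obs \<Rightarrow> (enat \<times> nat) measure" where
  "out x = distr (noise_space DZ DY) (count_space UNIV) (\<lambda>(z, y). test_output l0 l1 x z y)"

text \<open>A version of the conditional output probability given \<open>Z = z\<close>: by
  independence, \<open>z\<close> is held fixed while the query noise is averaged.\<close>

definition out_given :: "obs \<Rightarrow> real \<Rightarrow> enat \<times> nat \<Rightarrow> ennreal" where
  "out_given x z q = emeasure (query_noise DY)
     {y \<in> space (query_noise DY). test_output l0 l1 x z y = q}"

definition survival :: "obs \<Rightarrow> real \<Rightarrow> nat \<Rightarrow> ennreal" where
  "survival x z n = emeasure (query_noise DY)
     {y \<in> space (query_noise DY). enat n < fst (test_output l0 l1 x z y)}"

lemmas test_output_measurable = measurable_test_output[OF DZ DY, of l0 l1, unfolded noise_space_def]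

lemma test_output_section_measurable:
  "test_output l0 l1 x z \<in> measurable (query_noise DY) (count_space UNIV)"
  using measurable_Pair2[OF test_output_measurable, of z x] by simp

lemma emeasure_section_measurable:
  "(\<lambda>z. emeasure (query_noise DY) {y \<in> space (query_noise DY). P (test_output l0 l1 x z y)})
     \<in> borel_measurable borel"
proof -
  let ?X = "(\<lambda>(z, y). test_output l0 l1 x z y) -` Collect P \<inter> space (DZ \<Otimes>\<^sub>M query_noise DY)"
  have "?X \<in> sets (DZ \<Otimes>\<^sub>M query_noise DY)"
    by (rule measurable_sets[OF test_output_measurable]) simp
  then have "(\<lambda>z. emeasure (query_noise DY) (Pair z -` ?X)) \<in> borel_measurable DZ"
    by (rule Q.measurable_emeasure_Pair)
  also have "(\<lambda>z. Pair z -` ?X)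
    = (\<lambda>z. {y \<in> space (query_noise DY). P (test_output l0 l1 x z y)})"
    by (auto simp: space_pair_measure fun_eq_iff)
  finally show ?thesis by (simp cong: measurable_cong_sets)
qed

lemma out_given_measurable [measurable]: "(\<lambda>z. out_given x z q) \<in> borel_measurable borel"
  unfolding out_given_def by (rule emeasure_section_measurable)

lemma survival_measurable [measurable]: "(\<lambda>z. survival x z n) \<in> borel_measurable borel"
  unfolding survival_def by (rule emeasure_section_measurable)

lemma prob_space_out: "prob_space (out x)"
  unfolding out_def
  by (intro prob_space.prob_space_distr prob_space_noise_space measurable_test_output DZ DY)

lemma sets_out [simp, measurable_cong]: "sets (out x) = UNIV"
  by (simp add: out_def)

lemma emeasure_out: "emeasure (out x) {q} = (\<integral>\<^sup>+ z. out_given x z q \<partial>DZ)"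
proof -
  let ?X = "(\<lambda>(z, y). test_output l0 l1 x z y) -` {q} \<inter> space (DZ \<Otimes>\<^sub>M query_noise DY)"
  have X: "?X \<in> sets (DZ \<Otimes>\<^sub>M query_noise DY)"
    by (rule measurable_sets[OF test_output_measurable]) simp
  have "emeasure (out x) {q} = emeasure (DZ \<Otimes>\<^sub>M query_noise DY) ?X"
    unfolding out_def noise_space_def
    by (rule emeasure_distr[OF test_output_measurable]) simp
  also have "\<dots> = (\<integral>\<^sup>+ z. emeasure (query_noise DY) (Pair z -` ?X) \<partial>DZ)"
    by (rule Q.emeasure_pair_measure_alt[OF X])
  also have "\<dots> = (\<integral>\<^sup>+ z. out_given x z q \<partial>DZ)"
    unfolding out_given_def
    by (intro nn_integral_cong arg_cong[where f = "emeasure _"]) (auto simp: space_pair_measure)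
  finally show ?thesis .
qed

section \<open>Factorization over independent rounds\<close>

lemma survival_eq_prod: "survival x z n = (\<Prod>m\<in>{1..n}. emeasure DY (continue l0 l1 x z m))"
  unfolding survival_def less_fst_test_output_iff query_noise_def
  by (rule YS.emeasure_PiM_Collect) auto

lemma out_given_Suc:
  assumes "d \<in> {0, 1}"
  shows "out_given x z (enat (Suc n), d)
    = survival x z n * emeasure DY (accept l0 l1 x z (Suc n) d)"
proof -
  \<comment> \<open>Stopping in round \<open>Suc n\<close> is a cylinder event: its last factor is
    an acceptance region, all earlier ones are continuation regions.\<close>
  let ?X = "\<lambda>m. if m = Suc n then accept l0 l1 x z m d else continue l0 l1 x z m"
  have "out_given x z (enat (Suc n), d)
    = emeasure (query_noise DY) {y \<in> space (query_noise DY). \<forall>m\<in>{1..Suc n}. y m \<in> ?X m}"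
    unfolding out_given_def test_output_eq_Suc_iff[OF assms]
    by (intro arg_cong[where f = "emeasure _"]) (auto simp: atLeastAtMostSuc_conv)
  also have "\<dots> = (\<Prod>m\<in>{1..Suc n}. emeasure DY (?X m))"
    unfolding query_noise_def by (rule YS.emeasure_PiM_Collect) auto
  also have "\<dots> = survival x z n * emeasure DY (accept l0 l1 x z (Suc n) d)"
  proof -
    have "(\<Prod>m\<in>{1..n}. emeasure DY (?X m)) = survival x z n"
      unfolding survival_eq_prod by (intro prod.cong) auto
    then show ?thesis by (simp add: atLeastAtMostSuc_conv mult.commute)
  qed
  finally show ?thesis .
qed

text \<open>The tail-sum formula for the expectation; through it the survival probabilities of the
  rounds assemble into the conditional expectation of the bound.\<close>

lemma nn_integral_tau:
  "(\<integral>\<^sup>+ y. ennreal_of_enat (fst (test_output l0 l1 x z y)) \<partial>query_noise DY) = (\<Sum>n. survival x z n)"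
  unfolding survival_def
  by (rule nn_integral_enat_function)
    (rule measurable_compose[OF test_output_section_measurable], simp)

lemma survival_cong:
  "(\<And>i. i < n \<Longrightarrow> x i = x' i) \<Longrightarrow> survival x z n = survival x' z n"
  unfolding survival_eq_prod by (intro prod.cong refl arg_cong[where f = "emeasure _"] continue_cong) auto

lemma out_cong:
  assumes "d \<in> {0, 1}" "\<And>i. i < Suc n \<Longrightarrow> x i = x' i"
  shows "emeasure (out x) {(enat (Suc n), d)} = emeasure (out x') {(enat (Suc n), d)}"
  unfolding emeasure_out out_given_Suc[OF assms(1)]
  using survival_cong[of n x x'] accept_cong[of "Suc n" x x' l0 l1 _ d] assms(2) by simp

lemma survival_mono:
  assumes "\<And>m. \<bar>obs_sum x m - obs_sum x' m\<bar> \<le> 1"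
  shows "survival x (z - 1) n \<le> survival x' z n"
  unfolding survival_eq_prod using assms
  by (intro prod_mono_ennreal emeasure_mono continue_mono) auto

section \<open>The pointwise privacy bound\<close>

lemma out_pointwise_dp:
  assumes x: "\<And>m. \<bar>obs_sum x m - obs_sum x' m\<bar> \<le> 1" and d: "d \<in> {0, 1}"
    and Z: "distr DZ borel (\<lambda>w. 1 + w) \<le> scale_measure (ennreal (exp \<epsilon>Z)) DZ"
    and Y: "\<And>s. \<bar>s\<bar> \<le> 2 \<Longrightarrow>
      distr DY borel (\<lambda>w. s + w) \<le> scale_measure (ennreal (exp \<epsilon>Y)) DY"
  shows "emeasure (out x) {(enat (Suc n), d)}
    \<le> ennreal (exp (\<epsilon>Z + \<epsilon>Y)) * emeasure (out x') {(enat (Suc n), d)}"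
proof -
  let ?q = "(enat (Suc n), d)"
  have 1: "emeasure DY (accept l0 l1 x (z - 1) (Suc n) d)
      \<le> ennreal (exp \<epsilon>Y) * emeasure DY (accept l0 l1 x' z (Suc n) d)" for z
  proof -
    obtain s where s: "\<bar>s\<bar> \<le> 2"
      "\<And>y. y \<in> accept l0 l1 x (z - 1) (Suc n) d \<Longrightarrow> s + y \<in> accept l0 l1 x' z (Suc n) d"
      by (rule accept_shift[OF x[of "Suc n"] _ d]) auto
    have "emeasure DY (accept l0 l1 x (z - 1) (Suc n) d)
      \<le> emeasure DY ((\<lambda>y. s + y) -` accept l0 l1 x' z (Suc n) d \<inter> space DY)"
      using s(2) by (intro emeasure_mono measurable_sets[of _ _ borel]) auto
    also have "\<dots> = emeasure (distr DY borel (\<lambda>y. s + y)) (accept l0 l1 x' z (Suc n) d)"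
      by (subst emeasure_distr) auto
    also have "\<dots> \<le> emeasure (scale_measure (ennreal (exp \<epsilon>Y)) DY) (accept l0 l1 x' z (Suc n) d)"
      using Y[OF s(1)] by (subst (asm) le_measure) auto
    finally show ?thesis by simp
  qed
  \<comment> \<open>Earlier rounds are free by \<open>survival_mono\<close>, so
    \<open>\<epsilon>Y\<close> is paid only once, for the last round.\<close>
  have 2: "out_given x (z - 1) ?q \<le> ennreal (exp \<epsilon>Y) * out_given x' z ?q" for z
    using mult_mono[OF survival_mono[OF x] 1] unfolding out_given_Suc[OF d]
    by (simp add: mult_ac)
  \<comment> \<open>Writing \<open>z\<close> as \<open>1 + z - 1\<close> turns this into an integral
    over the law of \<open>1 + Z\<close>, with the run on \<open>x\<close> using
    \<open>z - 1\<close>.\<close>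
  have "emeasure (out x) {?q} = (\<integral>\<^sup>+ z. out_given x (1 + z - 1) ?q \<partial>DZ)"
    by (simp add: emeasure_out)
  also have "\<dots> = (\<integral>\<^sup>+ z. out_given x (z - 1) ?q \<partial>distr DZ borel (\<lambda>w. 1 + w))"
    by (subst nn_integral_distr) auto
  also have "\<dots> \<le> (\<integral>\<^sup>+ z. out_given x (z - 1) ?q \<partial>scale_measure (ennreal (exp \<epsilon>Z)) DZ)"
    by (rule nn_integral_mono_measure[OF _ Z]) simp
  also have "\<dots> = ennreal (exp \<epsilon>Z) * (\<integral>\<^sup>+ z. out_given x (z - 1) ?q \<partial>DZ)"
    by (rule nn_integral_scale_measure) simp
  also have "\<dots> \<le> ennreal (exp \<epsilon>Z) * (\<integral>\<^sup>+ z. ennreal (exp \<epsilon>Y) * out_given x' z ?q \<partial>DZ)"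
    by (intro mult_left_mono nn_integral_mono 2) simp
  also have "\<dots> = ennreal (exp (\<epsilon>Z + \<epsilon>Y)) * emeasure (out x') {?q}"
    by (simp add: nn_integral_cmult emeasure_out exp_add ennreal_mult mult.assoc)
  finally show ?thesis .
qed

section \<open>Moment inequalities for one round\<close>

text \<open>Here \<open>z\<close> is fixed: \<open>a\<close> stands for the likelihood ratio of
  \<open>Z\<close>, and \<open>w d\<close> for the contact point of the tangent at decision
  \<open>d\<close>. The shifted decision is charged to \<open>?U\<close> and the unshifted one to
  \<open>?V\<close>, which \<open>split_moment_bound\<close> controls jointly.\<close>

lemma round_tangent:
  fixes w :: "nat \<Rightarrow> real"
  assumes x: "\<bar>obs_sum x n - obs_sum x' n\<bar> = 1" and n: "1 \<le> n" and \<alpha>: "1 < \<alpha>"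
    and Y: "\<And>s. \<bar>s\<bar> \<le> 2 \<Longrightarrow>
      \<exists>\<rho>. shift_density DY s \<rho> \<and> (\<integral>\<^sup>+ y. ennreal (\<rho> y powr \<alpha>) \<partial>DY) \<le> E"
    and a: "0 \<le> a" and w: "\<And>d. 0 \<le> w d"
  shows "(\<Sum>d\<in>{0, 1}. ennreal (\<alpha> * w d powr (\<alpha> - 1) * a)
        * emeasure DY (accept l0 l1 x (z - 1) n d))
    \<le> ennreal (a powr \<alpha>) * (ennreal (sqrt 2) * E)
      + (\<Sum>d\<in>{0, 1}. ennreal ((\<alpha> - 1) * w d powr \<alpha>) * emeasure DY (accept l0 l1 x' z n d))"
proof -
  obtain d e s where de: "d \<in> {0, 1}" "e = 1 - d" and s: "\<bar>s\<bar> \<le> 2"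
    and sh: "\<And>y. y \<in> accept l0 l1 x (z - 1) n d \<Longrightarrow> s + y \<in> accept l0 l1 x' z n d"
    and fixed: "accept l0 l1 x (z - 1) n e \<subseteq> accept l0 l1 x' z n e"
    by (rule accept_one_sided_shift[OF x n, of l0 l1]) blast
  obtain \<rho> where \<rho>: "shift_density DY s \<rho>" and E: "(\<integral>\<^sup>+ y. ennreal (\<rho> y powr \<alpha>) \<partial>DY) \<le> E"
    using Y[OF s] by blast
  have \<rho>_meas [measurable]: "\<rho> \<in> borel_measurable borel" and \<rho>0: "\<And>y. 0 \<le> \<rho> y"
    and shift: "\<And>g. g \<in> borel_measurable borel \<Longrightarrow>
      (\<integral>\<^sup>+ y. g (s + y) \<partial>DY) = (\<integral>\<^sup>+ y. ennreal (\<rho> y) * g y \<partial>DY)"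
    using \<rho> by (auto simp: shift_density_def)
  let ?A = "\<lambda>d. accept l0 l1 x (z - 1) n d" and ?A' = "\<lambda>d. accept l0 l1 x' z n d"
  \<comment> \<open>\<open>B\<close> is the region of \<open>d\<close> moved by \<open>s\<close>;
    integrating the shift density over it gives the mass of the unmoved region.\<close>
  define B where "B = (\<lambda>y. y - s) -` ?A d"
  have B [measurable]: "B \<in> sets borel"
    unfolding B_def using measurable_sets[of "\<lambda>y. y - s" borel borel "?A d"] by simp
  have B_sub: "B \<subseteq> ?A' d"
    using sh by (force simp: B_def)
  have A_d: "emeasure DY (?A d) = (\<integral>\<^sup>+ y. ennreal (\<rho> y) * indicator B y \<partial>DY)"
  proof -
    have "emeasure DY (?A d) = (\<integral>\<^sup>+ y. indicator (?A d) y \<partial>DY)" by simp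
    also have "\<dots> = (\<integral>\<^sup>+ y. indicator B (s + y) \<partial>DY)"
      by (intro nn_integral_cong) (simp add: B_def indicator_def)
    also have "\<dots> = (\<integral>\<^sup>+ y. ennreal (\<rho> y) * indicator B y \<partial>DY)"
      by (rule shift) simp
    finally show ?thesis .
  qed
  have int: "(\<integral>\<^sup>+ y. ennreal (\<rho> y) \<partial>DY) = 1"
    using shift[of "\<lambda>_. 1"] Y.emeasure_space_1 by simp
  let ?U = "\<integral>\<^sup>+ y. ennreal (\<rho> y powr \<alpha>) * indicator B y \<partial>DY"
  let ?V = "\<integral>\<^sup>+ y. ennreal (\<rho> y) * indicator (space DY - B) y \<partial>DY"
  have UV: "?U + ?V \<le> ennreal (sqrt 2) * E"
    using split_moment_bound[OF Y.prob_space_axioms _ \<rho>0 int \<alpha>, of B] E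
      mult_left_mono[OF E, of "ennreal (sqrt 2)"] by (auto elim: order.trans)
  \<comment> \<open>The two regions are disjoint and \<open>\<rho>\<close> has total mass 1, so
    \<open>?A e\<close> fits into the mass that \<open>\<rho>\<close> leaves outside
    \<open>B\<close>.\<close>
  have A_e: "emeasure DY (?A e) \<le> ?V"
  proof -
    have "emeasure DY (?A d) + emeasure DY (?A e) = emeasure DY (?A d \<union> ?A e)"
      using accept_disjoint[of l0 l1 x "z - 1" n] de by (intro plus_emeasure) auto
    also have "\<dots> \<le> (\<integral>\<^sup>+ y. ennreal (\<rho> y) \<partial>DY)"
      unfolding int by (rule Y.emeasure_le_1)
    also have "\<dots> = emeasure DY (?A d) + ?V"
      unfolding A_d by (subst nn_integral_add[symmetric])
        (auto intro!: nn_integral_cong simp: indicator_def)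
    finally show ?thesis by simp
  qed
  have "ennreal (\<alpha> * w d powr (\<alpha> - 1) * a) * emeasure DY (?A d)
    = (\<integral>\<^sup>+ y. ennreal (\<alpha> * w d powr (\<alpha> - 1) * a) * (ennreal (\<rho> y) * indicator B y) \<partial>DY)"
    unfolding A_d by (simp add: nn_integral_cmult)
  also have "\<dots> \<le> (\<integral>\<^sup>+ y. ennreal (a powr \<alpha>) * (ennreal (\<rho> y powr \<alpha>) * indicator B y)
      + ennreal ((\<alpha> - 1) * w d powr \<alpha>) * indicator B y \<partial>DY)"
  proof (rule nn_integral_mono)
    fix y
    \<comment> \<open>The tangent is applied to \<open>a * \<rho> y\<close>, the joint ratio of
      \<open>Z\<close> and the query noise.\<close>
    have "\<alpha> * w d powr (\<alpha> - 1) * a * \<rho> y \<le> a powr \<alpha> * \<rho> y powr \<alpha> + (\<alpha> - 1) * w d powr \<alpha>"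
      using powr_tangent[of "a * \<rho> y" "w d" \<alpha>] a \<rho>0[of y] w[of d] \<alpha>
      by (simp add: powr_mult mult_ac)
    then show "ennreal (\<alpha> * w d powr (\<alpha> - 1) * a) * (ennreal (\<rho> y) * indicator B y)
      \<le> ennreal (a powr \<alpha>) * (ennreal (\<rho> y powr \<alpha>) * indicator B y)
        + ennreal ((\<alpha> - 1) * w d powr \<alpha>) * indicator B y"
      using \<alpha> a \<rho>0[of y]
      by (cases "y \<in> B") (simp_all add: ennreal_plus[symmetric] ennreal_mult[symmetric]
          ennreal_leI del: ennreal_plus)
  qed
  also have "\<dots> = ennreal (a powr \<alpha>) * ?U + ennreal ((\<alpha> - 1) * w d powr \<alpha>) * emeasure DY B"
    by (simp add: nn_integral_add nn_integral_cmult)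
  also have "\<dots> \<le> ennreal (a powr \<alpha>) * ?U + ennreal ((\<alpha> - 1) * w d powr \<alpha>) * emeasure DY (?A' d)"
    by (intro add_left_mono mult_left_mono emeasure_mono B_sub) auto
  finally have d: "ennreal (\<alpha> * w d powr (\<alpha> - 1) * a) * emeasure DY (?A d)
    \<le> ennreal (a powr \<alpha>) * ?U + ennreal ((\<alpha> - 1) * w d powr \<alpha>) * emeasure DY (?A' d)" .
  \<comment> \<open>Without a shift the ratio of the query noise is 1, and the joint ratio is
    \<open>a\<close>.\<close>
  have "ennreal (\<alpha> * w e powr (\<alpha> - 1) * a) * emeasure DY (?A e)
    \<le> (ennreal (a powr \<alpha>) + ennreal ((\<alpha> - 1) * w e powr \<alpha>)) * emeasure DY (?A e)"
    using powr_tangent[of a "w e" \<alpha>] a w[of e] \<alpha>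
    by (intro mult_right_mono) (simp_all add: ennreal_plus[symmetric] ennreal_leI del: ennreal_plus)
  also have "\<dots> \<le> ennreal (a powr \<alpha>) * ?V + ennreal ((\<alpha> - 1) * w e powr \<alpha>) * emeasure DY (?A' e)"
    unfolding distrib_right by (intro add_mono mult_left_mono A_e emeasure_mono fixed) auto
  finally have e: "ennreal (\<alpha> * w e powr (\<alpha> - 1) * a) * emeasure DY (?A e)
    \<le> ennreal (a powr \<alpha>) * ?V + ennreal ((\<alpha> - 1) * w e powr \<alpha>) * emeasure DY (?A' e)" .
  have sum2: "(\<Sum>i\<in>{0, 1}. f i) = f d + f e" for f :: "nat \<Rightarrow> ennreal"
    using de by (auto simp: add.commute)
  have "ennreal (\<alpha> * w d powr (\<alpha> - 1) * a) * emeasure DY (?A d)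
      + ennreal (\<alpha> * w e powr (\<alpha> - 1) * a) * emeasure DY (?A e)
    \<le> ennreal (a powr \<alpha>) * (?U + ?V) + (ennreal ((\<alpha> - 1) * w d powr \<alpha>) * emeasure DY (?A' d)
      + ennreal ((\<alpha> - 1) * w e powr \<alpha>) * emeasure DY (?A' e))"
    using add_mono[OF d e] by (simp only: distrib_left add_ac)
  also have "\<dots> \<le> ennreal (a powr \<alpha>) * (ennreal (sqrt 2) * E)
      + (ennreal ((\<alpha> - 1) * w d powr \<alpha>) * emeasure DY (?A' d)
      + ennreal ((\<alpha> - 1) * w e powr \<alpha>) * emeasure DY (?A' e))"
    by (intro add_right_mono mult_left_mono UV) simp
  finally show ?thesis unfolding sum2 .
qed

section \<open>The Renyi divergence of the outputs\<close>

lemma emeasure_out_off_support: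
  assumes "\<not> (\<exists>n d. d \<in> {0, 1} \<and> q = (enat (Suc n), d))" "q \<noteq> (\<infinity>, 0)"
  shows "emeasure (out x) {q} = 0"
proof -
  have "test_output l0 l1 x z y \<noteq> q" for z y
    by (cases rule: test_output_cases[of l0 l1 x z y]) (use assms in auto)
  then show ?thesis by (simp add: emeasure_out out_given_def)
qed

context
  fixes x x' :: obs and k :: nat and \<alpha> :: real and \<rho> :: "real \<Rightarrow> real" and E :: ennreal
  assumes agree: "\<And>i. i \<noteq> k \<Longrightarrow> x i = x' i"
    and \<alpha>: "1 < \<alpha>"
    and \<rho>: "shift_density DZ 1 \<rho>"
    and Y: "\<And>s. \<bar>s\<bar> \<le> 2 \<Longrightarrow>
      \<exists>\<rho>. shift_density DY s \<rho> \<and> (\<integral>\<^sup>+ y. ennreal (\<rho> y powr \<alpha>) \<partial>DY) \<le> E"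
begin

text \<open>Indexed by the rounds survived: \<open>round_cost n\<close> is the budget of round
  \<open>Suc n\<close>, which is reached with conditional probability
  \<open>survival x' z n\<close>.\<close>

definition round_cost :: "nat \<Rightarrow> ennreal" where
  "round_cost n = ennreal (sqrt 2) * E * (\<integral>\<^sup>+ z. ennreal (\<rho> z powr \<alpha>) * survival x' z n \<partial>DZ)"

definition total_cost :: ennreal where
  "total_cost =
     ennreal (sqrt 2) * E * (\<integral>\<^sup>+ z. ennreal (\<rho> z powr \<alpha>) * (\<Sum>n. survival x' z n) \<partial>DZ)"

lemma \<rho>_measurable [measurable]: "\<rho> \<in> borel_measurable borel"
  and \<rho>_nonneg: "0 \<le> \<rho> w"
  and \<rho>_shift: "g \<in> borel_measurable borel \<Longrightarrow>
      (\<integral>\<^sup>+ w. g (1 + w) \<partial>DZ) = (\<integral>\<^sup>+ w. ennreal (\<rho> w) * g w \<partial>DZ)"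
  using \<rho> by (auto simp: shift_density_def)

lemma suminf_round_cost: "(\<Sum>n. round_cost n) = total_cost"
proof -
  have "(\<Sum>n. round_cost n)
    = ennreal (sqrt 2) * E * (\<Sum>n. \<integral>\<^sup>+ z. ennreal (\<rho> z powr \<alpha>) * survival x' z n \<partial>DZ)"
    by (simp add: round_cost_def)
  also have "(\<Sum>n. \<integral>\<^sup>+ z. ennreal (\<rho> z powr \<alpha>) * survival x' z n \<partial>DZ)
    = (\<integral>\<^sup>+ z. (\<Sum>n. ennreal (\<rho> z powr \<alpha>) * survival x' z n) \<partial>DZ)"
    by (rule nn_integral_suminf[symmetric]) simp
  finally show ?thesis by (simp add: total_cost_def)
qed

lemma obs_sum_close: "\<bar>obs_sum x m - obs_sum x' m\<bar> \<le> 1"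
  using obs_sum_diff[of k x x' m, OF agree] by simp

lemma emeasure_out_shift:
  "emeasure (out x) {q} = (\<integral>\<^sup>+ z. ennreal (\<rho> z) * out_given x (z - 1) q \<partial>DZ)"
proof -
  have "emeasure (out x) {q} = (\<integral>\<^sup>+ z. out_given x (1 + z - 1) q \<partial>DZ)"
    by (simp add: emeasure_out)
  also have "\<dots> = (\<integral>\<^sup>+ z. ennreal (\<rho> z) * out_given x (z - 1) q \<partial>DZ)"
    by (rule \<rho>_shift) simp
  finally show ?thesis .
qed

text \<open>\<open>round_tangent\<close> at \<open>a = \<rho> z\<close>, weighted by the probability
  of reaching the round and averaged over \<open>z\<close>. The contact points do not depend on
  \<open>z\<close>, which leaves them free to be the likelihood ratio of the whole output.\<close>

lemma out_tangent:
  fixes w :: "nat \<Rightarrow> real"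
  assumes n: "\<bar>obs_sum x (Suc n) - obs_sum x' (Suc n)\<bar> = 1" and w: "\<And>d. 0 \<le> w d"
  shows "(\<Sum>d\<in>{0, 1}. ennreal (\<alpha> * w d powr (\<alpha> - 1)) * emeasure (out x) {(enat (Suc n), d)})
    \<le> round_cost n
      + (\<Sum>d\<in>{0, 1}. ennreal ((\<alpha> - 1) * w d powr \<alpha>) * emeasure (out x') {(enat (Suc n), d)})"
proof -
  have pt: "(\<Sum>d\<in>{0, 1}. ennreal (\<alpha> * w d powr (\<alpha> - 1))
        * (ennreal (\<rho> z) * out_given x (z - 1) (enat (Suc n), d)))
    \<le> ennreal (sqrt 2) * E * (ennreal (\<rho> z powr \<alpha>) * survival x' z n)
      + (\<Sum>d\<in>{0, 1}. ennreal ((\<alpha> - 1) * w d powr \<alpha>) * out_given x' z (enat (Suc n), d))" for z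
  proof -
    have "(\<Sum>d\<in>{0, 1}. ennreal (\<alpha> * w d powr (\<alpha> - 1))
        * (ennreal (\<rho> z) * out_given x (z - 1) (enat (Suc n), d)))
      = survival x (z - 1) n * (\<Sum>d\<in>{0, 1}. ennreal (\<alpha> * w d powr (\<alpha> - 1) * \<rho> z)
        * emeasure DY (accept l0 l1 x (z - 1) (Suc n) d))"
      unfolding sum_distrib_left using \<alpha> \<rho>_nonneg
      by (intro sum.cong refl) (simp add: out_given_Suc ennreal_mult mult_ac)
    \<comment> \<open>Survival of \<open>x\<close> at \<open>z - 1\<close> is dominated by survival
      of \<open>x'\<close> at \<open>z\<close>, so that the right-hand side refers to
      \<open>x'\<close> only.\<close>
    also have "\<dots> \<le> survival x' z n * (ennreal (\<rho> z powr \<alpha>) * (ennreal (sqrt 2) * E)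
      + (\<Sum>d\<in>{0, 1}. ennreal ((\<alpha> - 1) * w d powr \<alpha>)
        * emeasure DY (accept l0 l1 x' z (Suc n) d)))"
      by (intro mult_mono survival_mono obs_sum_close round_tangent n \<alpha> Y \<rho>_nonneg w) auto
    also have "\<dots> = ennreal (sqrt 2) * E * (ennreal (\<rho> z powr \<alpha>) * survival x' z n)
      + (\<Sum>d\<in>{0, 1}. ennreal ((\<alpha> - 1) * w d powr \<alpha>) * out_given x' z (enat (Suc n), d))"
      by (simp add: out_given_Suc distrib_left mult_ac)
    finally show ?thesis .
  qed
  have "(\<Sum>d\<in>{0, 1}. ennreal (\<alpha> * w d powr (\<alpha> - 1)) * emeasure (out x) {(enat (Suc n), d)})
    = (\<integral>\<^sup>+ z. (\<Sum>d\<in>{0, 1}. ennreal (\<alpha> * w d powr (\<alpha> - 1))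
        * (ennreal (\<rho> z) * out_given x (z - 1) (enat (Suc n), d))) \<partial>DZ)"
    unfolding emeasure_out_shift by (simp add: nn_integral_add nn_integral_cmult)
  also have "\<dots> \<le> (\<integral>\<^sup>+ z. ennreal (sqrt 2) * E * (ennreal (\<rho> z powr \<alpha>) * survival x' z n)
      + (\<Sum>d\<in>{0, 1}. ennreal ((\<alpha> - 1) * w d powr \<alpha>) * out_given x' z (enat (Suc n), d)) \<partial>DZ)"
    by (intro nn_integral_mono pt)
  also have "\<dots> = round_cost n
      + (\<Sum>d\<in>{0, 1}. ennreal ((\<alpha> - 1) * w d powr \<alpha>) * emeasure (out x') {(enat (Suc n), d)})"
    unfolding round_cost_def emeasure_out by (simp add: nn_integral_add nn_integral_cmult)
  finally show ?thesis .
qed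

lemma changed_round:
  assumes "k < Suc n" "x k \<noteq> x' k"
  shows "\<bar>obs_sum x (Suc n) - obs_sum x' (Suc n)\<bar> = 1"
  using obs_sum_diff[of k x x' "Suc n", OF agree] assms by auto

lemma unchanged_round:
  assumes "\<not> (k < Suc n \<and> x k \<noteq> x' k)" "d \<in> {0, 1}"
  shows "emeasure (out x) {(enat (Suc n), d)} = emeasure (out x') {(enat (Suc n), d)}"
  by (rule out_cong) (use assms agree in \<open>metis\<close>)+

text \<open>Never stopping means staying in all continuation regions, which
  \<open>continue_mono\<close> preserves for the same query noise.\<close>

lemma out_given_infinity_mono:
  "out_given x (z - 1) (\<infinity>, 0) \<le> out_given x' z (\<infinity>, 0)"
proof -
  have iff: "test_output l0 l1 x z y = (\<infinity>, 0) \<longleftrightarrow> (\<forall>n. \<forall>m\<in>{1..n}. y m \<in> continue l0 l1 x z m)"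
    for x z y
    unfolding fst_test_output_eq_infinity_iff[symmetric] less_fst_test_output_iff[symmetric]
    by (cases "fst (test_output l0 l1 x z y)") auto
  have "{y \<in> space (query_noise DY). test_output l0 l1 x' z y = (\<infinity>, 0)} \<in> sets (query_noise DY)"
    using measurable_sets[OF test_output_section_measurable[of x' z], of "{(\<infinity>, 0)}"]
    by (simp add: vimage_def Int_def conj_commute)
  moreover have "test_output l0 l1 x' z y = (\<infinity>, 0)" if "test_output l0 l1 x (z - 1) y = (\<infinity>, 0)" for y
    unfolding iff
  proof (intro allI ballI)
    fix n m :: nat assume m: "m \<in> {1..n}"
    then have "y m \<in> continue l0 l1 x (z - 1) m" using that[unfolded iff] by blast
    then show "y m \<in> continue l0 l1 x' z m" using continue_mono[OF obs_sum_close[of m], of l0 l1 z] m by auto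
  qed
  ultimately show ?thesis
    unfolding out_given_def by (intro emeasure_mono) auto
qed

section \<open>Absolute continuity and the divergence integral under finite moments\<close>

context
  assumes E: "E \<noteq> \<top>"
    and \<rho>2: "(\<integral>\<^sup>+ z. ennreal (\<rho> z powr (2 * \<alpha>)) \<partial>DZ) \<noteq> \<top>"
    and second_moment: "(\<integral>\<^sup>+ z. (\<Sum>n. survival x' z n)\<^sup>2 \<partial>DZ) \<noteq> \<top>"
begin

text \<open>Cauchy-Schwarz in \<open>z\<close> raises the order of the moment of
  \<open>\<rho>\<close> from \<open>\<alpha>\<close> to \<open>2 * \<alpha>\<close>; squaring
  \<open>sqrt 2\<close> gives the factor 2 inside the logarithm of the theorem.\<close>

lemma total_cost_square:
  "total_cost\<^sup>2 \<le> 2 * E\<^sup>2 * ((\<integral>\<^sup>+ z. ennreal (\<rho> z powr (2 * \<alpha>)) \<partial>DZ)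
     * (\<integral>\<^sup>+ z. (\<Sum>n. survival x' z n)\<^sup>2 \<partial>DZ))"
proof -
  have "(\<integral>\<^sup>+ z. ennreal (\<rho> z powr \<alpha>) * (\<Sum>n. survival x' z n) \<partial>DZ)\<^sup>2
    \<le> (\<integral>\<^sup>+ z. (ennreal (\<rho> z powr \<alpha>))\<^sup>2 \<partial>DZ) * (\<integral>\<^sup>+ z. (\<Sum>n. survival x' z n)\<^sup>2 \<partial>DZ)"
    by (rule Cauchy_Schwarz_nn_integral) auto
  also have "(\<lambda>z. (ennreal (\<rho> z powr \<alpha>))\<^sup>2) = (\<lambda>z. ennreal (\<rho> z powr (2 * \<alpha>)))"
    unfolding mult_2 powr_add power2_eq_square by (simp add: ennreal_mult)
  finally have "(ennreal (sqrt 2))\<^sup>2 * E\<^sup>2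
      * (\<integral>\<^sup>+ z. ennreal (\<rho> z powr \<alpha>) * (\<Sum>n. survival x' z n) \<partial>DZ)\<^sup>2
    \<le> (ennreal (sqrt 2))\<^sup>2 * E\<^sup>2 * ((\<integral>\<^sup>+ z. ennreal (\<rho> z powr (2 * \<alpha>)) \<partial>DZ)
     * (\<integral>\<^sup>+ z. (\<Sum>n. survival x' z n)\<^sup>2 \<partial>DZ))"
    by (intro mult_left_mono) auto
  moreover have "(ennreal (sqrt 2))\<^sup>2 = 2"
    by (simp add: ennreal_power)
  ultimately show ?thesis
    by (simp add: total_cost_def power_mult_distrib)
qed

lemma total_cost_finite: "total_cost \<noteq> \<top>"
proof
  assume "total_cost = \<top>"
  then have "2 * E\<^sup>2 * ((\<integral>\<^sup>+ z. ennreal (\<rho> z powr (2 * \<alpha>)) \<partial>DZ)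
     * (\<integral>\<^sup>+ z. (\<Sum>n. survival x' z n)\<^sup>2 \<partial>DZ)) = \<top>"
    using total_cost_square by (simp add: top_unique power2_eq_square ennreal_mult_eq_top_iff)
  then show False
    using E \<rho>2 second_moment by (auto simp: ennreal_mult_eq_top_iff power2_eq_square)
qed

lemma round_cost_finite: "round_cost n \<noteq> \<top>"
proof -
  have "round_cost n \<le> total_cost"
    unfolding suminf_round_cost[symmetric] using sum_le_suminf[of round_cost "{n}"] by simp
  then show ?thesis using total_cost_finite by (auto simp: top_unique)
qed

text \<open>A finite second moment makes the conditional expectation of the stopping time finite for
  almost every \<open>z\<close>, and then the test stops almost surely.\<close>

lemma out_given_infinity_null: "AE z in DZ. out_given x' z (\<infinity>, 0) = 0"
proof -
  have "AE z in DZ. (\<Sum>n. survival x' z n)\<^sup>2 \<noteq> \<infinity>"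
    by (rule nn_integral_PInf_AE) (use second_moment in simp_all)
  then show ?thesis
  proof eventually_elim
    case (elim z)
    have [measurable]: "test_output l0 l1 x' z \<in> measurable (query_noise DY) (count_space UNIV)"
      by (rule test_output_section_measurable)
    have "(\<integral>\<^sup>+ y. ennreal_of_enat (fst (test_output l0 l1 x' z y)) \<partial>query_noise DY) \<noteq> \<infinity>"
      unfolding nn_integral_tau using elim by (auto simp: power2_eq_square ennreal_mult_eq_top_iff)
    then have "AE y in query_noise DY. ennreal_of_enat (fst (test_output l0 l1 x' z y)) \<noteq> \<infinity>"
      by (intro nn_integral_PInf_AE measurable_compose[OF test_output_section_measurable]) simp_all
    then have "AE y in query_noise DY.
        y \<notin> {y \<in> space (query_noise DY). test_output l0 l1 x' z y = (\<infinity>, 0)}"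
      by eventually_elim auto
    then have "{y \<in> space (query_noise DY). test_output l0 l1 x' z y = (\<infinity>, 0)}
        \<in> null_sets (query_noise DY)"
      by (subst AE_iff_null_sets) auto
    then show ?case by (simp add: out_given_def null_sets_def)
  qed
qed

lemma emeasure_out_infinity:
  "emeasure (out x') {(\<infinity>, 0)} = 0" "emeasure (out x) {(\<infinity>, 0)} = 0"
proof -
  show "emeasure (out x') {(\<infinity>, 0)} = 0"
    unfolding emeasure_out using out_given_infinity_null by (subst nn_integral_0_iff_AE) auto
  have "AE z in DZ. ennreal (\<rho> z) * out_given x (z - 1) (\<infinity>, 0) = 0"
    using out_given_infinity_null
    by eventually_elim (use out_given_infinity_mono in \<open>metis le_zero_eq mult_zero_right\<close>)
  then show "emeasure (out x) {(\<infinity>, 0)} = 0"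
    unfolding emeasure_out_shift by (subst nn_integral_0_iff_AE) auto
qed

text \<open>Suppose an output of a changed round has probability 0 under \<open>x'\<close>. The
  tangent inequality, with contact point \<open>t\<close> there and 0 at the other decision, bounds
  an arbitrarily large multiple of its probability under \<open>x\<close> by the finite cost of the
  round.\<close>

lemma absolutely_continuous_out: "absolutely_continuous (out x') (out x)"
proof -
  have pt: "emeasure (out x) {q} = 0" if q: "emeasure (out x') {q} = 0" for q
  proof (cases "\<exists>n d. d \<in> {0, 1} \<and> q = (enat (Suc n), d)")
    case False
    then show ?thesis
      using emeasure_out_infinity(2) emeasure_out_off_support[of q x] by auto
  next
    case True
    then obtain n d where d: "d \<in> {0, 1}" and nd: "q = (enat (Suc n), d)" by blast
    show ?thesis
    proof (cases "k < Suc n \<and> x k \<noteq> x' k")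
      case False
      then show ?thesis using unchanged_round[OF False d] q nd by simp
    next
      case True
      then have ch: "\<bar>obs_sum x (Suc n) - obs_sum x' (Suc n)\<bar> = 1"
        by (intro changed_round) auto
      have le: "ennreal (\<alpha> * t powr (\<alpha> - 1)) * emeasure (out x) {q} \<le> round_cost n"
        if t: "0 \<le> t" for t
      proof -
        have sum2: "(\<Sum>i\<in>{0, 1}. f i) = f d + f (1 - d)" for f :: "nat \<Rightarrow> ennreal"
          using d by (auto simp: add.commute)
        define w where "w e = (if e = d then t else 0)" for e
        have w: "w d = t" "w (1 - d) = 0" using d by (auto simp: w_def)
        have "(\<Sum>d\<in>{0, 1}. ennreal (\<alpha> * w d powr (\<alpha> - 1)) * emeasure (out x) {(enat (Suc n), d)})
          \<le> round_cost n + (\<Sum>d\<in>{0, 1}.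
            ennreal ((\<alpha> - 1) * w d powr \<alpha>) * emeasure (out x') {(enat (Suc n), d)})"
          by (rule out_tangent[OF ch]) (simp add: w_def t)
        then show ?thesis
          unfolding sum2 w nd[symmetric] q by simp
      qed
      obtain h where h: "round_cost n = ennreal h" "0 \<le> h"
        using round_cost_finite by (cases "round_cost n") auto
      interpret P: prob_space "out x" by (rule prob_space_out)
      let ?p = "measure (out x) {q}"
      have le': "\<alpha> * t * ?p \<le> h" if "0 \<le> t" for t
      proof -
        \<comment> \<open>The exponent \<open>1 / (\<alpha> - 1)\<close> undoes the power
          \<open>\<alpha> - 1\<close>, making the bound linear in \<open>t\<close>.\<close>
        have "ennreal (\<alpha> * t * ?p) \<le> ennreal h"
          using le[of "t powr (1 / (\<alpha> - 1))"] that \<alpha> h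
          by (simp add: powr_powr P.emeasure_eq_measure ennreal_mult)
        then show ?thesis using h by simp
      qed
      have "?p = 0"
      proof (rule ccontr)
        assume "?p \<noteq> 0"
        then have "?p > 0" by (simp add: zero_less_measure_iff)
        \<comment> \<open>This choice of \<open>t\<close> would give
          \<open>h + 1 \<le> h\<close>.\<close>
        then show False
          using le'[of "(h + 1) / (\<alpha> * ?p)"] \<alpha> h by simp
      qed
      then show ?thesis by (simp add: P.emeasure_eq_measure)
    qed
  qed
  show ?thesis
    unfolding absolutely_continuous_def
  proof
    fix A assume A: "A \<in> null_sets (out x')"
    show "A \<in> null_sets (out x)"
      by (rule countable_null_setsI[OF sets_out pt]) (rule null_sets_singleton[OF A sets_out])
  qed
qed

text \<open>Lets the budget of round 1 pay for all unchanged rounds, whose probabilities add up to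
  at most 1. Each factor is at least 1, the moments by \<open>one_le_moment\<close>.\<close>

lemma one_le_round_cost_0: "1 \<le> round_cost 0"
proof -
  \<comment> \<open>The shift by 0 is admissible, and its moment already bounds \<open>E\<close>
    from below by 1.\<close>
  obtain \<rho>Y where \<rho>Y: "shift_density DY 0 \<rho>Y" "(\<integral>\<^sup>+ y. ennreal (\<rho>Y y powr \<alpha>) \<partial>DY) \<le> E"
    using Y[of 0] by auto
  note [measurable] = shift_densityD(1)[OF \<rho>Y(1)]
  have "1 \<le> (\<integral>\<^sup>+ y. ennreal (\<rho>Y y powr \<alpha>) \<partial>DY)"
    by (intro one_le_moment Y.prob_space_axioms \<alpha> shift_densityD(2)[OF \<rho>Y(1)]
        shift_density_total[OF Y.prob_space_axioms \<rho>Y(1)]) simp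
  then have E1: "1 \<le> E" using \<rho>Y(2) by (rule order.trans)
  have "(\<integral>\<^sup>+ z. ennreal (\<rho> z) \<partial>DZ) = 1"
    by (rule shift_density_total[OF Z.prob_space_axioms \<rho>])
  then have Z1: "1 \<le> (\<integral>\<^sup>+ z. ennreal (\<rho> z powr \<alpha>) \<partial>DZ)"
    using \<alpha> \<rho>_nonneg by (intro one_le_moment Z.prob_space_axioms) auto
  have "(1 :: ennreal) \<le> ennreal (sqrt 2)"
    using ennreal_leI[of 1 "sqrt 2"] by simp
  then have "1 * 1 * 1 \<le> ennreal (sqrt 2) * E * (\<integral>\<^sup>+ z. ennreal (\<rho> z powr \<alpha>) \<partial>DZ)"
    by (intro mult_mono E1 Z1) auto
  moreover have "survival x' z 0 = 1" for z by (simp add: survival_eq_prod)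
  ultimately show ?thesis by (simp add: round_cost_def)
qed

lemma AE_out_support: "AE q in out x'. \<exists>n d. d \<in> {0, 1} \<and> q = (enat (Suc n), d)"
proof -
  let ?N = "{q :: enat \<times> nat. \<not> (\<exists>n d. d \<in> {0, 1} \<and> q = (enat (Suc n), d))}"
  have N: "?N \<in> null_sets (out x')"
  proof (rule countable_null_setsI[OF sets_out])
    fix q assume "q \<in> ?N"
    then show "emeasure (out x') {q} = 0"
      using emeasure_out_off_support[of q x'] emeasure_out_infinity(1) by (cases "q = (\<infinity>, 0)") simp_all
  qed
  show ?thesis by (rule AE_I'[OF N]) blast
qed

text \<open>Up to a null set only finite stopping times occur, and grouping the outputs by round
  turns the integral into a series.\<close>

lemma nn_integral_out:
  fixes f :: "enat \<times> nat \<Rightarrow> ennreal"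
  shows "(\<integral>\<^sup>+ q. f q \<partial>out x')
    = (\<Sum>n. \<Sum>d\<in>{0, 1}. f (enat (Suc n), d) * emeasure (out x') {(enat (Suc n), d)})"
proof -
  let ?S = "\<lambda>n. {(enat (Suc n), 0), (enat (Suc n), 1)}"
  have "(\<integral>\<^sup>+ q. f q \<partial>out x') = (\<integral>\<^sup>+ q. (\<Sum>n. f q * indicator (?S n) q) \<partial>out x')"
  proof (rule nn_integral_cong_AE)
    show "AE q in out x'. f q = (\<Sum>n. f q * indicator (?S n) q)"
      using AE_out_support
    proof eventually_elim
      case (elim q)
      then obtain n d where "d \<in> {0, 1}" "q = (enat (Suc n), d)" by blast
      then show ?case by (subst suminf_finite[of "{n}"]) auto
    qed
  qed
  also have "\<dots> = (\<Sum>n. \<integral>\<^sup>+ q. f q * indicator (?S n) q \<partial>out x')"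
    by (rule nn_integral_suminf) (simp add: measurable_def)
  also have "\<dots> = (\<Sum>n. \<Sum>d\<in>{0, 1}. f (enat (Suc n), d) * emeasure (out x') {(enat (Suc n), d)})"
    by (intro suminf_cong, subst nn_integral_indicator_finite) auto
  finally show ?thesis .
qed

text \<open>Changed rounds are charged to their \<open>round_cost\<close>; in unchanged rounds the
  likelihood ratio is 1, so they contribute their own probability.\<close>

lemma renyi_integral_le:
  "(\<integral>\<^sup>+ q. ennreal (enn2real (RN_deriv (out x') (out x) q) powr \<alpha>) \<partial>out x') \<le> total_cost"
proof -
  interpret R: prob_space "out x'" by (rule prob_space_out)
  let ?W = "\<lambda>q. enn2real (RN_deriv (out x') (out x) q)"
  let ?p = "\<lambda>n d. emeasure (out x) {(enat (Suc n), d)}"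
  let ?q = "\<lambda>n d. emeasure (out x') {(enat (Suc n), d)}"
  have W: "?p n d = ennreal (?W (enat (Suc n), d)) * ?q n d" for n d
    by (rule R.countable_RN_deriv[OF absolutely_continuous_out]) (simp_all add: prob_space_out)
  define X where "X n = (\<Sum>d\<in>{0, 1}. ennreal (?W (enat (Suc n), d) powr \<alpha>) * ?q n d)" for n
  have integral: "(\<integral>\<^sup>+ q. ennreal (?W q powr \<alpha>) \<partial>out x') = (\<Sum>n. X n)"
    unfolding X_def by (rule nn_integral_out)
  have changed: "X n \<le> round_cost n" if "k < Suc n" "x k \<noteq> x' k" for n
  proof (rule ennreal_le_of_scaled[OF _ \<alpha>])
    let ?w = "\<lambda>d. ?W (enat (Suc n), d)"
    \<comment> \<open>The contact point is the likelihood ratio itself: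
      \<open>?w d powr (\<alpha> - 1)\<close> times the probability under \<open>x\<close> is
      \<open>?w d powr \<alpha>\<close> times that under \<open>x'\<close>, so both sums become
      multiples of \<open>X n\<close>.\<close>
    have "ennreal \<alpha> * X n = (\<Sum>d\<in>{0, 1}. ennreal (\<alpha> * ?w d powr (\<alpha> - 1)) * ?p n d)"
    proof -
      have "ennreal (\<alpha> * ?w d powr (\<alpha> - 1)) * ?p n d
          = ennreal \<alpha> * (ennreal (?w d powr \<alpha>) * ?q n d)" for d
      proof -
        have "?w d powr (\<alpha> - 1) * ?w d = ?w d powr \<alpha>"
          by (cases "?w d = 0") (simp_all add: powr_diff)
        then have "ennreal (\<alpha> * ?w d powr (\<alpha> - 1)) * ennreal (?w d)
          = ennreal \<alpha> * ennreal (?w d powr \<alpha>)"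
          using \<alpha> by (simp add: ennreal_mult[symmetric] mult.assoc)
        then show ?thesis unfolding W mult.assoc[symmetric] by simp
      qed
      then show ?thesis by (simp only: X_def sum_distrib_left)
    qed
    also have "\<dots> \<le> round_cost n + (\<Sum>d\<in>{0, 1}. ennreal ((\<alpha> - 1) * ?w d powr \<alpha>) * ?q n d)"
      by (rule out_tangent[OF changed_round[OF that]]) simp
    also have "(\<Sum>d\<in>{0, 1}. ennreal ((\<alpha> - 1) * ?w d powr \<alpha>) * ?q n d) = ennreal (\<alpha> - 1) * X n"
      using \<alpha> unfolding X_def sum_distrib_left
      by (intro sum.cong refl) (simp add: ennreal_mult mult.assoc)
    finally show "ennreal \<alpha> * X n \<le> round_cost n + ennreal (\<alpha> - 1) * X n" .
    show "X n \<noteq> \<top>"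
      by (simp add: X_def ennreal_mult_eq_top_iff R.emeasure_eq_measure)
  qed
  have unchanged: "X n = (\<Sum>d\<in>{0, 1}. 1 * ?q n d)" if "\<not> (k < Suc n \<and> x k \<noteq> x' k)" for n
    unfolding X_def
  proof (rule sum.cong[OF refl])
    fix d :: nat assume d: "d \<in> {0, 1}"
    show "ennreal (?W (enat (Suc n), d) powr \<alpha>) * ?q n d = 1 * ?q n d"
    \<comment> \<open>The ratio is determined only where the probability under \<open>x'\<close> is
      positive; elsewhere it carries no weight.\<close>
    proof (cases "?q n d = 0")
      case False
      have "ennreal (?W (enat (Suc n), d)) * ?q n d = 1 * ?q n d"
        using W[of n d] unchanged_round[OF that d] by simp
      then have "?W (enat (Suc n), d) * measure (out x') {(enat (Suc n), d)}
          = measure (out x') {(enat (Suc n), d)}"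
        by (simp add: R.emeasure_eq_measure ennreal_mult[symmetric])
      then have "?W (enat (Suc n), d) = 1"
        using False by (simp add: R.emeasure_eq_measure)
      then show ?thesis by simp
    qed simp
  qed
  show ?thesis
  \<comment> \<open>If the first observation is altered, every round is changed. Otherwise round 1
    is unchanged and its budget is free.\<close>
  proof (cases "k < Suc 0 \<and> x k \<noteq> x' k")
    case True
    then show ?thesis
      unfolding integral suminf_round_cost[symmetric] by (intro suminf_le changed) auto
  next
    case False
    \<comment> \<open>The budget of round 1, at index 0, is held back and later covers the total
      output probability 1. Allowing every round its own probability, changed ones included, keeps
      that total at exactly 1.\<close>
    define h where "h n = (if n = 0 then 0 else round_cost n)" for n
    have "X n \<le> h n + (\<Sum>d\<in>{0, 1}. 1 * ?q n d)" for n
    proof (cases "k < Suc n \<and> x k \<noteq> x' k")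
      case True
      then have "n \<noteq> 0" using False by auto
      then show ?thesis using changed[of n] True by (simp add: h_def add_increasing2)
    next
      case False
      then show ?thesis unfolding unchanged[OF False] by simp
    qed
    then have "(\<Sum>n. X n) \<le> (\<Sum>n. h n + (\<Sum>d\<in>{0, 1}. 1 * ?q n d))"
      by (intro suminf_le) auto
    also have "\<dots> = (\<Sum>n. h n) + (\<Sum>n. \<Sum>d\<in>{0, 1}. 1 * ?q n d)"
      by (rule suminf_add[symmetric]) auto
    also have "(\<Sum>n. \<Sum>d\<in>{0, 1}. 1 * ?q n d) = 1"
      using nn_integral_out[of "\<lambda>_. 1"] R.emeasure_space_1 by simp
    also have "(\<Sum>n. h n) + 1 \<le> (\<Sum>n. h n) + (\<Sum>n. if n = 0 then round_cost 0 else 0)"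
    proof (rule add_left_mono)
      have "(\<Sum>n. if n = 0 then round_cost 0 else 0) = round_cost 0"
        by (subst suminf_finite[of "{0}"]) auto
      then show "1 \<le> (\<Sum>n. if n = 0 then round_cost 0 else 0)"
        using one_le_round_cost_0 by simp
    qed
    also have "\<dots> = (\<Sum>n. h n + (if n = 0 then round_cost 0 else 0))"
      by (rule suminf_add) auto
    also have "\<dots> = total_cost"
      unfolding suminf_round_cost[symmetric] by (intro suminf_cong) (simp add: h_def)
    finally show ?thesis unfolding integral .
  qed
qed

end
end

section \<open>Both privacy guarantees for the output law\<close>

lemma test_dp_out:
  assumes "\<And>f. has_sensitivity f 1 \<Longrightarrow> dp \<epsilon>Z (noise_mech DZ f)"
    and "\<And>f. has_sensitivity f 2 \<Longrightarrow> dp \<epsilon>Y (noise_mech DY f)"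
  shows "test_dp (\<epsilon>Z + \<epsilon>Y) out"
  unfolding test_dp_def
proof (intro allI impI ballI)
  fix x x' :: obs and t d :: nat
  assume "neighboring x x'" and d: "d \<in> {0, 1}"
  then obtain k where k: "\<And>i. i \<noteq> k \<Longrightarrow> x i = x' i" by (auto simp: neighboring_def)
  interpret P: prob_space "out x" by (rule prob_space_out)
  interpret P': prob_space "out x'" by (rule prob_space_out)
  show "measure (out x) {(enat t, d)} \<le> exp (\<epsilon>Z + \<epsilon>Y) * measure (out x') {(enat t, d)}"
  proof (cases t)
    case 0
    then have "emeasure (out x) {(enat t, d)} = 0"
      by (intro emeasure_out_off_support) auto
    then show ?thesis by (simp add: measure_def)
  next
    case (Suc n)
    have "\<bar>obs_sum x m - obs_sum x' m\<bar> \<le> 1" for m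
      using obs_sum_diff[of k x x' m, OF k] by simp
    then have "emeasure (out x) {(enat (Suc n), d)}
        \<le> ennreal (exp (\<epsilon>Z + \<epsilon>Y)) * emeasure (out x') {(enat (Suc n), d)}"
      by (rule out_pointwise_dp[OF _ d dp_shift[OF DZ _ assms(1)] dp_shift[OF DY _ assms(2)]]) auto
    then show ?thesis
      by (simp add: Suc P.emeasure_eq_measure P'.emeasure_eq_measure ennreal_mult[symmetric])
  qed
qed

lemma renyi_div_out:
  assumes Z: "\<And>f. has_sensitivity f 1 \<Longrightarrow> rdp_profile \<epsilon>Z (noise_mech DZ f)"
    and Y: "\<And>f. has_sensitivity f 2 \<Longrightarrow> rdp_profile \<epsilon>Y (noise_mech DY f)"
    and \<alpha>: "1 < \<alpha>" and nb: "neighboring x x'"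
  shows "renyi_div \<alpha> (out x) (out x')
    \<le> ereal ((\<alpha> - 1 / 2) / (\<alpha> - 1) * \<epsilon>Z (2 * \<alpha>)) + ereal (\<epsilon>Y \<alpha>)
      + ln_ennreal (2 * (\<integral>\<^sup>+ z. (\<Sum>n. survival x' z n)\<^sup>2 \<partial>DZ)) / ereal (2 * (\<alpha> - 1))"
proof (cases "(\<integral>\<^sup>+ z. (\<Sum>n. survival x' z n)\<^sup>2 \<partial>DZ) = \<top>")
  case True
  \<comment> \<open>An infinite second moment makes the right-hand side
    \<open>\<infinity>\<close>.\<close>
  then show ?thesis using \<alpha> by (simp add: ln_ennreal_def ennreal_mult_top)
next
  case False
  from nb obtain k where k: "\<And>i. i \<noteq> k \<Longrightarrow> x i = x' i" by (auto simp: neighboring_def)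
  let ?E = "ennreal (exp ((\<alpha> - 1) * \<epsilon>Y \<alpha>))"
  \<comment> \<open>The density for \<open>Z\<close> is taken at order \<open>2 * \<alpha>\<close>,
    the order left by the Cauchy-Schwarz inequality.\<close>
  obtain \<rho> where \<rho>: "shift_density DZ 1 \<rho>"
    and \<rho>2: "(\<integral>\<^sup>+ w. ennreal (\<rho> w powr (2 * \<alpha>)) \<partial>DZ) \<le> ennreal (exp ((2 * \<alpha> - 1) * \<epsilon>Z (2 * \<alpha>)))"
    by (rule rdp_shift_density[OF DZ, of 1 1 "2 * \<alpha>" "\<epsilon>Z (2 * \<alpha>)"])
      (use Z \<alpha> in \<open>auto simp: rdp_profile_def\<close>)
  have DY': "\<exists>\<rho>. shift_density DY s \<rho> \<and> (\<integral>\<^sup>+ y. ennreal (\<rho> y powr \<alpha>) \<partial>DY) \<le> ?E"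
    if "\<bar>s\<bar> \<le> 2" for s
    by (rule rdp_shift_density[OF DY that \<alpha>, of "\<epsilon>Y \<alpha>"])
      (use Y \<alpha> in \<open>auto simp: rdp_profile_def\<close>)
  have \<rho>2': "(\<integral>\<^sup>+ w. ennreal (\<rho> w powr (2 * \<alpha>)) \<partial>DZ) \<noteq> \<top>"
    using \<rho>2 by (auto simp: top_unique)
  \<comment> \<open>The test runs for at least one round, so the tail at \<open>n = 0\<close>
    already contributes 1.\<close>
  have J: "1 \<le> (\<integral>\<^sup>+ z. (\<Sum>n. survival x' z n)\<^sup>2 \<partial>DZ)"
  proof -
    have "1 \<le> (\<Sum>n. survival x' z n)\<^sup>2" for z
    proof -
      have "survival x' z 0 \<le> (\<Sum>n. survival x' z n)"
        using sum_le_suminf[of "survival x' z" "{0}"] by simp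
      then show ?thesis by (intro one_le_power) (simp add: survival_eq_prod)
    qed
    then have "(\<integral>\<^sup>+ z. 1 \<partial>DZ) \<le> (\<integral>\<^sup>+ z. (\<Sum>n. survival x' z n)\<^sup>2 \<partial>DZ)"
      by (intro nn_integral_mono)
    then show ?thesis using Z.emeasure_space_1 by simp
  qed
  have ac: "absolutely_continuous (out x') (out x)"
    by (rule absolutely_continuous_out[OF k \<alpha> \<rho> DY' _ \<rho>2' False]) auto
  have "(\<integral>\<^sup>+ q. ennreal (enn2real (RN_deriv (out x') (out x) q) powr \<alpha>) \<partial>out x')
    \<le> total_cost x' \<alpha> \<rho> ?E"
    by (rule renyi_integral_le[OF k \<alpha> \<rho> DY' _ \<rho>2' False]) auto
  moreover have "(total_cost x' \<alpha> \<rho> ?E)\<^sup>2 \<le> 2 * ?E\<^sup>2 * ((\<integral>\<^sup>+ z. ennreal (\<rho> z powr (2 * \<alpha>)) \<partial>DZ)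
     * (\<integral>\<^sup>+ z. (\<Sum>n. survival x' z n)\<^sup>2 \<partial>DZ))"
    by (rule total_cost_square[OF k \<alpha> \<rho> DY' _ \<rho>2' False]) auto
  ultimately show ?thesis
    unfolding renyi_div_def if_P[OF ac]
    by (rule renyi_bound_arith[OF _ _ refl \<rho>2 J False \<alpha>])
qed

end

theorem theorem2:
  fixes \<theta>0 \<theta>1 \<alpha>err \<beta>err \<gamma> :: real
    and C :: "nat \<Rightarrow> real \<Rightarrow> real"
    and DZ DY :: "real measure"
  assumes "\<theta>0 < \<theta>1"
    and "0 < \<alpha>err" "\<alpha>err < 1" "0 < \<beta>err" "\<beta>err < 1" "0 < \<gamma>" "\<gamma> < 1"
    and "continuous_distribution DZ" "continuous_distribution DY"
  shows
    "(\<forall>\<epsilon>Z \<epsilon>Y :: real.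
        (\<forall>f. has_sensitivity f 1 \<longrightarrow> dp \<epsilon>Z (noise_mech DZ f)) \<longrightarrow>
        (\<forall>f. has_sensitivity f 2 \<longrightarrow> dp \<epsilon>Y (noise_mech DY f)) \<longrightarrow>
        test_dp (\<epsilon>Z + \<epsilon>Y) (dp_sprt \<theta>0 \<theta>1 \<alpha>err \<beta>err \<gamma> C DZ DY))
     \<and>
     (\<forall>\<epsilon>Z \<epsilon>Y :: real \<Rightarrow> real.
        (\<forall>f. has_sensitivity f 1 \<longrightarrow> rdp_profile \<epsilon>Z (noise_mech DZ f)) \<longrightarrow>
        (\<forall>f. has_sensitivity f 2 \<longrightarrow> rdp_profile \<epsilon>Y (noise_mech DY f)) \<longrightarrow>
        (\<forall>\<alpha> D D'. 1 < \<alpha> \<longrightarrow> neighboring D D' \<longrightarrow>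
           renyi_div \<alpha> (dp_sprt \<theta>0 \<theta>1 \<alpha>err \<beta>err \<gamma> C DZ DY D)
                       (dp_sprt \<theta>0 \<theta>1 \<alpha>err \<beta>err \<gamma> C DZ DY D')
           \<le> ereal ((\<alpha> - 1 / 2) / (\<alpha> - 1) * \<epsilon>Z (2 * \<alpha>)) + ereal (\<epsilon>Y \<alpha>)
             + ln_ennreal (2 * (\<integral>\<^sup>+ z. (cond_exp_tau \<theta>0 \<theta>1 \<alpha>err \<beta>err \<gamma> C DY D' z)\<^sup>2 \<partial>DZ))
               / ereal (2 * (\<alpha> - 1))))"
proof -
  interpret noisy_test DZ DY "ell0 \<theta>0 \<theta>1 \<beta>err \<gamma> C" "ell1 \<theta>0 \<theta>1 \<alpha>err \<gamma> C"
    by unfold_locales (use assms in simp_all)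
  have out: "dp_sprt \<theta>0 \<theta>1 \<alpha>err \<beta>err \<gamma> C DZ DY = out"
    by (simp add: fun_eq_iff dp_sprt_def out_def)
  have tau: "cond_exp_tau \<theta>0 \<theta>1 \<alpha>err \<beta>err \<gamma> C DY x z = (\<Sum>n. survival x z n)" for x z
    unfolding cond_exp_tau_def by (rule nn_integral_tau)
  show ?thesis
    unfolding out tau using test_dp_out renyi_div_out by blast
qed

end
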